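(* Let $\lambda\in K$ and let $S\subseteq K\langle X;\Omega\rangle$, $\Omega=\{P,D\}$, be the set of $\Omega$-polynomials $P(x)P(y)-P(xP(y))-P(P(x)y)-\lambda P(xy)$, $D(xy)-D(x)y-xD(y)-\lambda D(x)D(y)$, $D(P(x))-x$ for $x,y\in\mathfrak{S}(X)$. Then $K\langle X;\Omega|S\rangle=K\langle X;\Omega\rangle/Id(S)$ is a free $\lambda$-differential Rota–Baxter algebra on the set $X$, with $K$-basis $\Phi(D^\omega(X))$.
   Context: $K$ is a commutative ring with unit. A $\lambda$-differential Rota–Baxter algebra is an associative $K$-algebra $R$ with $K$-linear $P,D:R\to R$ such that for all $x,y\in R$: $P(x)P(y)=P(xP(y))+P(P(x)y)+\lambda P(xy)$; $D(xy)=D(x)y+xD(y)+\lambda D(x)D(y)$; $D(P(x))=x$. Free on $X$ means every map from $X$ to such an algebra extends uniquely to an algebra homomorphism commuting with $P$ and $D$. $S(Y)$ free semigroup; $\mathfrak{S}_0=S(X)$, $\mathfrak{S}_n=S(X\cup\{P(u),D(u)\mid u\in\mathfrak{S}_{n-1}\})$, $\mathfrak{S}(X)=\bigcup_n\mathfrak{S}_n$; $K\langle X;\Omega\rangle$ is the free $K$-module on $\mathfrak{S}(X)$ with concatenation product and $P,D$ extended linearly; $Id(S)$ is the $K$-span of all $u|_s$, $u$ a word on $X\cup\{\star\}$ with exactly one $\star$, $s\in S$ substituted for $\star$. $D^\omega(X)=\{D^i(x)\mid i\ge0,x\in X\}$, $D^0(x)=x$. For $Y,Z\subseteq\mathfrak{S}(X)$: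 $\Lambda^P(Y,Z)=\bigcup_{r\ge1}(YP(Z))^r\cup\bigcup_{r\ge0}(YP(Z))^rY\cup\bigcup_{r\ge1}(P(Z)Y)^r\cup\bigcup_{r\ge0}(P(Z)Y)^rP(Z)$; $\Phi_0=S(D^\omega(X))$, $\Phi_n=\Lambda^P(\Phi_0,\Phi_{n-1})$, $\Phi(D^\omega(X))=\bigcup_{n\ge0}\Phi_n$. *)

theory Defs
  imports Main
begin

text \<open>A letter is either a variable from X, or P(u), or D(u) for a bracketed word u.
  Words are lists of letters; the elements of the free operated semigroup
  frak-S(X) are the nonempty lists of well-formed letters.\<close>

datatype 'x letter = V 'x | PL "'x letter list" | DL "'x letter list"

inductive wfl :: "'x set \<Rightarrow> 'x letter \<Rightarrow> bool" for X :: "'x set" where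
  wfl_V: "x \<in> X \<Longrightarrow> wfl X (V x)"
| wfl_P: "u \<noteq> [] \<Longrightarrow> (\<forall>a\<in>set u. wfl X a) \<Longrightarrow> wfl X (PL u)"
| wfl_D: "u \<noteq> [] \<Longrightarrow> (\<forall>a\<in>set u. wfl X a) \<Longrightarrow> wfl X (DL u)"

definition wfw :: "'x set \<Rightarrow> 'x letter list \<Rightarrow> bool" where
  "wfw X w \<longleftrightarrow> w \<noteq> [] \<and> (\<forall>a\<in>set w. wfl X a)"

definition OMod :: "'x set \<Rightarrow> ('x letter list \<Rightarrow> 'k::comm_ring_1) set" where
  "OMod X = {f. finite {w. f w \<noteq> 0} \<and> (\<forall>w. f w \<noteq> 0 \<longrightarrow> wfw X w)}"

definition delta :: "'x letter list \<Rightarrow> 'x letter list \<Rightarrow> 'k::comm_ring_1" where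
  "delta w = (\<lambda>v. if v = w then 1 else 0)"

definition madd :: "('x letter list \<Rightarrow> 'k::comm_ring_1) \<Rightarrow> ('x letter list \<Rightarrow> 'k) \<Rightarrow> 'x letter list \<Rightarrow> 'k" where
  "madd f g = (\<lambda>w. f w + g w)"

definition msub :: "('x letter list \<Rightarrow> 'k::comm_ring_1) \<Rightarrow> ('x letter list \<Rightarrow> 'k) \<Rightarrow> 'x letter list \<Rightarrow> 'k" where
  "msub f g = (\<lambda>w. f w - g w)"

definition msmul :: "'k::comm_ring_1 \<Rightarrow> ('x letter list \<Rightarrow> 'k) \<Rightarrow> 'x letter list \<Rightarrow> 'k" where
  "msmul a f = (\<lambda>w. a * f w)"

definition mmul :: "('x letter list \<Rightarrow> 'k::comm_ring_1) \<Rightarrow> ('x letter list \<Rightarrow> 'k) \<Rightarrow> 'x letter list \<Rightarrow> 'k" where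
  "mmul f g = (\<lambda>w. \<Sum>i\<le>length w. f (take i w) * g (drop i w))"

definition mP :: "('x letter list \<Rightarrow> 'k::comm_ring_1) \<Rightarrow> 'x letter list \<Rightarrow> 'k" where
  "mP f = (\<lambda>w. case w of [PL u] \<Rightarrow> f u | _ \<Rightarrow> 0)"

definition mD :: "('x letter list \<Rightarrow> 'k::comm_ring_1) \<Rightarrow> 'x letter list \<Rightarrow> 'k" where
  "mD f = (\<lambda>w. case w of [DL u] \<Rightarrow> f u | _ \<Rightarrow> 0)"

definition rbpoly :: "'k::comm_ring_1 \<Rightarrow> ('x letter list \<Rightarrow> 'k) \<Rightarrow> ('x letter list \<Rightarrow> 'k) \<Rightarrow> 'x letter list \<Rightarrow> 'k" where
  "rbpoly lam u v = msub (msub (msub (mmul (mP u) (mP v)) (mP (mmul u (mP v))))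
                        (mP (mmul (mP u) v))) (msmul lam (mP (mmul u v)))"

definition dpoly :: "'k::comm_ring_1 \<Rightarrow> ('x letter list \<Rightarrow> 'k) \<Rightarrow> ('x letter list \<Rightarrow> 'k) \<Rightarrow> 'x letter list \<Rightarrow> 'k" where
  "dpoly lam u v = msub (msub (msub (mD (mmul u v)) (mmul (mD u) v)) (mmul u (mD v)))
                        (msmul lam (mmul (mD u) (mD v)))"

definition pdpoly :: "('x letter list \<Rightarrow> 'k::comm_ring_1) \<Rightarrow> 'x letter list \<Rightarrow> 'k" where
  "pdpoly u = msub (mD (mP u)) u"

definition Spolys :: "'k::comm_ring_1 \<Rightarrow> 'x set \<Rightarrow> ('x letter list \<Rightarrow> 'k) set" where
  "Spolys lam X =
     {rbpoly lam (delta x) (delta y) | x y. wfw X x \<and> wfw X y}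
   \<union> {dpoly lam (delta x) (delta y) | x y. wfw X x \<and> wfw X y}
   \<union> {pdpoly (delta x) | x. wfw X x}"

text \<open>Words on X \<union> {star} with exactly one star: l star r, l P(c) r, l D(c) r, where
  l, r are (possibly empty) words of well-formed letters and c is again such a starred word.\<close>
datatype 'x ctx = Hole "'x letter list" "'x letter list"
  | CP "'x letter list" "'x ctx" "'x letter list"
  | CD "'x letter list" "'x ctx" "'x letter list"

fun wfc :: "'x set \<Rightarrow> 'x ctx \<Rightarrow> bool" where
  "wfc X (Hole l r) = ((\<forall>a\<in>set l. wfl X a) \<and> (\<forall>a\<in>set r. wfl X a))"
| "wfc X (CP l c r) = ((\<forall>a\<in>set l. wfl X a) \<and> wfc X c \<and> (\<forall>a\<in>set r. wfl X a))"
| "wfc X (CD l c r) = ((\<forall>a\<in>set l. wfl X a) \<and> wfc X c \<and> (\<forall>a\<in>set r. wfl X a))"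

text \<open>u|_s: substitution of s for the star (delta [] is the empty word, acting as unit).\<close>
fun subst :: "'x ctx \<Rightarrow> ('x letter list \<Rightarrow> 'k::comm_ring_1) \<Rightarrow> 'x letter list \<Rightarrow> 'k" where
  "subst (Hole l r) s = mmul (mmul (delta l) s) (delta r)"
| "subst (CP l c r) s = mmul (mmul (delta l) (mP (subst c s))) (delta r)"
| "subst (CD l c r) s = mmul (mmul (delta l) (mD (subst c s))) (delta r)"

definition kspan :: "('w \<Rightarrow> 'k::comm_ring_1) set \<Rightarrow> ('w \<Rightarrow> 'k) set" where
  "kspan A = {f. \<exists>F c. finite F \<and> F \<subseteq> A \<and> f = (\<lambda>w. \<Sum>a\<in>F. c a * a w)}"

definition IdS :: "'k::comm_ring_1 \<Rightarrow> 'x set \<Rightarrow> ('x letter list \<Rightarrow> 'k) set" where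
  "IdS lam X = kspan {subst c s | c s. wfc X c \<and> s \<in> Spolys lam X}"

primrec Dpow :: "nat \<Rightarrow> 'x \<Rightarrow> 'x letter" where
  "Dpow 0 x = V x"
| "Dpow (Suc i) x = DL [Dpow i x]"

definition Domega :: "'x set \<Rightarrow> 'x letter list set" where
  "Domega X = {[Dpow i x] | i x. x \<in> X}"

definition sgrp :: "'a list set \<Rightarrow> 'a list set" where
  "sgrp Y = {concat ys | ys. ys \<noteq> [] \<and> set ys \<subseteq> Y}"

definition setcat :: "'a list set \<Rightarrow> 'a list set \<Rightarrow> 'a list set" where
  "setcat A B = {a @ b | a b. a \<in> A \<and> b \<in> B}"

primrec spow :: "'a list set \<Rightarrow> nat \<Rightarrow> 'a list set" where
  "spow A 0 = {[]}"
| "spow A (Suc r) = setcat A (spow A r)"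

definition PZ :: "'x letter list set \<Rightarrow> 'x letter list set" where
  "PZ Z = {[PL z] | z. z \<in> Z}"

definition LamP :: "'x letter list set \<Rightarrow> 'x letter list set \<Rightarrow> 'x letter list set" where
  "LamP Y Z =
     (\<Union>r\<in>{1..}. spow (setcat Y (PZ Z)) r)
   \<union> (\<Union>r. setcat (spow (setcat Y (PZ Z)) r) Y)
   \<union> (\<Union>r\<in>{1..}. spow (setcat (PZ Z) Y) r)
   \<union> (\<Union>r. setcat (spow (setcat (PZ Z) Y) r) (PZ Z))"

fun Phi :: "'x set \<Rightarrow> nat \<Rightarrow> 'x letter list set" where
  "Phi X 0 = sgrp (Domega X)"
| "Phi X (Suc n) = LamP (sgrp (Domega X)) (Phi X n)"

definition PhiD :: "'x set \<Rightarrow> 'x letter list set" where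
  "PhiD X = (\<Union>n. Phi X n)"

definition kalg :: "('k::comm_ring_1 \<Rightarrow> 'r::ring \<Rightarrow> 'r) \<Rightarrow> bool" where
  "kalg sm \<longleftrightarrow>
     (\<forall>a x y. sm a (x + y) = sm a x + sm a y) \<and>
     (\<forall>a b x. sm (a + b) x = sm a x + sm b x) \<and>
     (\<forall>a b x. sm (a * b) x = sm a (sm b x)) \<and>
     (\<forall>x. sm 1 x = x) \<and>
     (\<forall>a x y. sm a (x * y) = sm a x * y) \<and>
     (\<forall>a x y. sm a (x * y) = x * sm a y)"

definition klinear :: "('k::comm_ring_1 \<Rightarrow> 'r::ring \<Rightarrow> 'r) \<Rightarrow> ('r \<Rightarrow> 'r) \<Rightarrow> bool" where
  "klinear sm T \<longleftrightarrow> (\<forall>x y. T (x + y) = T x + T y) \<and> (\<forall>a x. T (sm a x) = sm a (T x))"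

definition ldrb :: "('k::comm_ring_1 \<Rightarrow> 'r::ring \<Rightarrow> 'r) \<Rightarrow> 'k \<Rightarrow> ('r \<Rightarrow> 'r) \<Rightarrow> ('r \<Rightarrow> 'r) \<Rightarrow> bool" where
  "ldrb sm lam P D \<longleftrightarrow> kalg sm \<and> klinear sm P \<and> klinear sm D \<and>
     (\<forall>x y. P x * P y = P (x * P y) + P (P x * y) + sm lam (P (x * y))) \<and>
     (\<forall>x y. D (x * y) = D x * y + x * D y + sm lam (D x * D y)) \<and>
     (\<forall>x. D (P x) = x)"

text \<open>Maps out of the quotient K<X;Omega>/I are represented by maps on K<X;Omega>
  vanishing on I.  phi is a K-algebra homomorphism commuting with P and D,
  vanishing on I and sending (the class of) x to e x.\<close>
definition qhom :: "'x set \<Rightarrow> ('x letter list \<Rightarrow> 'k::comm_ring_1) set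
    \<Rightarrow> ('k \<Rightarrow> 'r::ring \<Rightarrow> 'r) \<Rightarrow> ('r \<Rightarrow> 'r) \<Rightarrow> ('r \<Rightarrow> 'r) \<Rightarrow> ('x \<Rightarrow> 'r)
    \<Rightarrow> (('x letter list \<Rightarrow> 'k) \<Rightarrow> 'r) \<Rightarrow> bool" where
  "qhom X I sm P D e phi \<longleftrightarrow>
     (\<forall>f\<in>OMod X. \<forall>g\<in>OMod X. phi (madd f g) = phi f + phi g) \<and>
     (\<forall>a. \<forall>f\<in>OMod X. phi (msmul a f) = sm a (phi f)) \<and>
     (\<forall>f\<in>OMod X. \<forall>g\<in>OMod X. phi (mmul f g) = phi f * phi g) \<and>
     (\<forall>f\<in>OMod X. phi (mP f) = P (phi f)) \<and>
     (\<forall>f\<in>OMod X. phi (mD f) = D (phi f)) \<and>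
     (\<forall>f\<in>I. phi f = 0) \<and>
     (\<forall>x\<in>X. phi (delta [V x]) = e x)"

end

theory Submission
  imports Defs "HOL.Modules" "HOL-Library.Poly_Mapping"
begin

text \<open>
  Freeness is formal: words evaluate in any \<open>\<lambda>\<close>-differential Rota-Baxter algebra, and the linear
  extension kills the generators of Id(S). Reading the relations as rewrite rules from left to right
  shows that the words over \<open>D\<^sup>i(x)\<close> and \<open>P(z)\<close> without two adjacent P-letters span the quotient;
  these are the words of \<open>\<Phi>(D\<^sup>\<omega>(X))\<close>. Instead of checking compositions of a Groebner-Shirshov basis,
  linear independence is obtained from a model: the free module on the normal words (with the empty
  word as unit) is given a product, in which only P(z)P(y) is not a concatenation, and a derivation.
  It is a \<open>\<lambda>\<close>-differential Rota-Baxter algebra in which every normal word evaluates to itself, so a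
  combination of normal words lying in Id(S) is zero.
\<close>

section \<open>The operated algebra and the ideal\<close>

text \<open>The obstacle is associativity in the model. It comes down to the overlap P(a)P(b)P(c):
  both bracketings are P of an iterated double product, where the double product of a and b is aP(b)
  + P(a)b + lambda ab. This double product is associative once the ordinary product is associative
  on smaller triples. The overlap of the Rota-Baxter rule with D is milder: DP = id turns
  D(P(z)P(y)) into the double product of z and y, and its three terms are those of the Leibniz rule
  for P(z)P(y). The adjoined unit lets the recursions for product and derivation end at an empty
  tail. It also brings elements such as P(1) into the model; independence asks only that distinct
  normal words evaluate to distinct basis elements.\<close>

lemma mmul_Nil [simp]: "mmul f g [] = f [] * g []"
  by (simp add: mmul_def)

text \<open>Peeling off the first letter replaces \<open>f\<close> by its quotient
  \<open>\<lambda>v. f (a # v)\<close>, which is why associativity is proved by induction on the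
  word for all left factors at once.\<close>

lemma mmul_Cons: "mmul f g (a # w) = f [] * g (a # w) + mmul (\<lambda>v. f (a # v)) g w"
  unfolding mmul_def by (simp add: sum.atMost_Suc_shift del: sum.atMost_Suc)

text \<open>Linearity is asked on all functions, without a support condition: \<open>mmul\<close> is
  a finite sum at each single word, so the operations are linear there too, and linearity of
  composites needs no membership in \<open>OMod\<close>.\<close>

definition flinear :: "(('a \<Rightarrow> 'k::comm_ring_1) \<Rightarrow> ('b \<Rightarrow> 'k)) \<Rightarrow> bool" where
  "flinear L \<longleftrightarrow> (\<forall>f g. L (\<lambda>w. f w + g w) = (\<lambda>w. L f w + L g w)) \<and>
     (\<forall>a f. L (\<lambda>w. a * f w) = (\<lambda>w. a * L f w))"

lemma flinear_id: "flinear (\<lambda>f. f)"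
  and flinear_comp: "flinear L \<Longrightarrow> flinear M \<Longrightarrow> flinear (\<lambda>f. L (M f))"
  and flinear_msub: "flinear L' \<Longrightarrow> flinear M' \<Longrightarrow> flinear (\<lambda>f. msub (L' f) (M' f))"
  and flinear_msmul: "flinear L' \<Longrightarrow> flinear (\<lambda>f. msmul c (L' f))"
  by (auto simp: flinear_def msub_def msmul_def algebra_simps)

lemma flinear_mmul1: "flinear (\<lambda>f. mmul f g)"
  and flinear_mmul2: "flinear (\<lambda>g. mmul f g)"
  unfolding flinear_def mmul_def
  by (auto simp: algebra_simps sum.distrib sum_distrib_left intro!: ext)

lemma flinear_mP: "flinear mP" and flinear_mD: "flinear mD"
  unfolding flinear_def mP_def mD_def
  by (auto intro!: ext split: list.split letter.split)

lemmas flinear_intros = flinear_id flinear_msub flinear_msmul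
  flinear_mmul1 flinear_mmul2 flinear_mP flinear_mD
  flinear_comp[OF flinear_mmul1] flinear_comp[OF flinear_mmul2]
  flinear_comp[OF flinear_mP] flinear_comp[OF flinear_mD]

lemma flinear_rbpoly1: "flinear (\<lambda>f. rbpoly lam f g)"
  and flinear_rbpoly2: "flinear (\<lambda>g. rbpoly lam f g)"
  and flinear_dpoly1: "flinear (\<lambda>f. dpoly lam f g)"
  and flinear_dpoly2: "flinear (\<lambda>g. dpoly lam f g)"
  and flinear_pdpoly: "flinear (\<lambda>f. pdpoly f)"
  unfolding rbpoly_def dpoly_def pdpoly_def by (intro flinear_intros)+

lemma mmul_assoc: "mmul (mmul f g) h = mmul f (mmul g h)"
proof
  fix w show "mmul (mmul f g) h w = mmul f (mmul g h) w"
  proof (induction w arbitrary: f)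
    case (Cons a w)
    have "mmul (mmul f g) h (a # w) = f [] * g [] * h (a # w)
        + mmul (\<lambda>v. f [] * g (a # v) + mmul (\<lambda>v. f (a # v)) g v) h w"
      by (simp add: mmul_Cons)
    also have "mmul (\<lambda>v. f [] * g (a # v) + mmul (\<lambda>v. f (a # v)) g v) h w
        = f [] * mmul (\<lambda>v. g (a # v)) h w + mmul (mmul (\<lambda>v. f (a # v)) g) h w"
      using flinear_mmul1[of h] by (simp add: flinear_def)
    finally show ?case
      by (simp add: mmul_Cons Cons.IH algebra_simps)
  qed (simp add: mult.assoc)
qed

lemma mmul_zero [simp]: "mmul (\<lambda>w. 0) g = (\<lambda>w. 0)" "mmul g (\<lambda>w. 0) = (\<lambda>w. 0)"
  by (auto simp: mmul_def)

lemma mmul_delta_Nil_left [simp]: "mmul (delta []) f = f"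
proof
  fix w show "mmul (delta []) f w = f w"
    by (cases w) (simp_all add: mmul_Cons delta_def)
qed

lemma mmul_delta_delta [simp]: "mmul (delta u) (delta v) = delta (u @ v)"
proof
  fix w show "mmul (delta u) (delta v) w = (delta (u @ v) w :: 'b)"
  proof (induction u arbitrary: w)
    case (Cons a u)
    show ?case
    proof (cases w)
      case (Cons b w')
      show ?thesis
      proof (cases "b = a")
        case True
        have "(\<lambda>v. delta (a # u) (a # v) :: 'b) = delta u"
          by (auto simp: delta_def)
        then show ?thesis using Cons.IH[of w'] True Cons
          by (simp add: mmul_Cons) (simp add: delta_def)
      next
        case False
        have "(\<lambda>v. delta (a # u) (b # v) :: 'b) = (\<lambda>w. 0)"
          using False by (auto simp: delta_def)
        then show ?thesis using False Cons
          by (simp add: mmul_Cons) (simp add: delta_def)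
      qed
    qed (simp add: delta_def)
  qed simp
qed

lemma mmul_delta_Nil_right [simp]: "mmul f (delta []) = f"
proof
  fix w show "mmul f (delta []) w = f w"
    by (induction w arbitrary: f) (simp_all add: mmul_Cons delta_def)
qed

lemma mP_delta [simp]: "mP (delta u) = delta [PL u]"
  and mD_delta [simp]: "mD (delta u) = delta [DL u]"
  by (auto simp: mP_def mD_def delta_def intro!: ext split: list.split letter.split)

section \<open>Submodules of functions and spans\<close>

definition ksubmodule :: "('w \<Rightarrow> 'k::comm_ring_1) set \<Rightarrow> bool" where
  "ksubmodule S \<longleftrightarrow> (\<lambda>w. 0) \<in> S \<and> (\<forall>f\<in>S. \<forall>g\<in>S. (\<lambda>w. f w + g w) \<in> S) \<and>
     (\<forall>a. \<forall>f\<in>S. (\<lambda>w. a * f w) \<in> S)"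

lemma ksubmodule_add: "ksubmodule S \<Longrightarrow> f \<in> S \<Longrightarrow> g \<in> S \<Longrightarrow> (\<lambda>w. f w + g w) \<in> S"
  and ksubmodule_smul: "ksubmodule S \<Longrightarrow> f \<in> S \<Longrightarrow> (\<lambda>w. a * f w) \<in> S"
  and ksubmodule_zero: "ksubmodule S \<Longrightarrow> (\<lambda>w. 0) \<in> S"
  by (auto simp: ksubmodule_def)

lemma ksubmodule_sum:
  assumes "ksubmodule S" "\<And>i. i \<in> I \<Longrightarrow> f i \<in> S"
  shows "(\<lambda>w. \<Sum>i\<in>I. c i * f i w) \<in> S"
  using assms(2)
proof (induction I rule: infinite_finite_induct)
  case (insert i I)
  then show ?case
    using ksubmodule_add[OF assms(1) ksubmodule_smul[OF assms(1), of "f i" "c i"]] by simp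
qed (use ksubmodule_zero[OF assms(1)] in simp_all)

lemma ksubmodule_msub:
  assumes "ksubmodule S" "f \<in> S" "g \<in> S" shows "msub f g \<in> S"
  using ksubmodule_add[OF assms(1,2) ksubmodule_smul[OF assms(1,3), of "-1"]] by (simp add: msub_def)

lemma ksubmodule_madd: "ksubmodule S \<Longrightarrow> f \<in> S \<Longrightarrow> g \<in> S \<Longrightarrow> madd f g \<in> S"
  and ksubmodule_msmul: "ksubmodule S \<Longrightarrow> f \<in> S \<Longrightarrow> msmul a f \<in> S"
  by (simp_all add: madd_def msmul_def ksubmodule_add ksubmodule_smul)

lemma flinear_zero: "flinear L \<Longrightarrow> L (\<lambda>w. 0) = (\<lambda>w. 0)"
proof -
  assume "flinear L"
  then have "L (\<lambda>w. a * f w) = (\<lambda>w. a * L f w)" for a f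
    by (simp add: flinear_def)
  from this[of 0 "\<lambda>w. 0"] show ?thesis by simp
qed

text \<open>The reason why checking generators suffices: the set of \<open>f\<close> with
  \<open>L f\<close> in \<open>S\<close> is a submodule, so it contains a span as soon as it
  contains the generators.\<close>

lemma ksubmodule_vimage: "flinear L \<Longrightarrow> ksubmodule S \<Longrightarrow> ksubmodule {f. L f \<in> S}"
  using flinear_zero[of L] by (auto simp: ksubmodule_def flinear_def)

lemma kspan_superset: "A \<subseteq> kspan A"
proof
  fix f assume "f \<in> A"
  then show "f \<in> kspan A"
    unfolding kspan_def by (intro CollectI exI[of _ "{f}"] exI[of _ "\<lambda>_. 1"]) auto
qed

lemma kspan_minimal: "ksubmodule S \<Longrightarrow> A \<subseteq> S \<Longrightarrow> kspan A \<subseteq> S"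
  by (auto simp: kspan_def intro!: ksubmodule_sum[where f = "\<lambda>a. a"])

lemma ksubmodule_kspan: "ksubmodule (kspan A)"
  unfolding ksubmodule_def
proof (intro conjI ballI allI)
  show "(\<lambda>w. 0) \<in> kspan A"
    unfolding kspan_def by (intro CollectI exI[of _ "{}"]) auto
next
  fix f g assume "f \<in> kspan A" "g \<in> kspan A"
  then obtain F c G d where F: "finite F" "F \<subseteq> A" "f = (\<lambda>w. \<Sum>a\<in>F. c a * a w)"
    and G: "finite G" "G \<subseteq> A" "g = (\<lambda>w. \<Sum>a\<in>G. d a * a w)"
    unfolding kspan_def by blast
  have "(\<Sum>a\<in>F. c a * a w) = (\<Sum>a\<in>F \<union> G. (if a \<in> F then c a else 0) * a w)" for w
    by (rule sum.mono_neutral_cong_left) (use F G in auto)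
  moreover have "(\<Sum>a\<in>G. d a * a w) = (\<Sum>a\<in>F \<union> G. (if a \<in> G then d a else 0) * a w)" for w
    by (rule sum.mono_neutral_cong_left) (use F G in auto)
  ultimately have "(\<lambda>w. f w + g w) =
      (\<lambda>w. \<Sum>a\<in>F \<union> G. ((if a \<in> F then c a else 0) + (if a \<in> G then d a else 0)) * a w)"
    unfolding F(3) G(3) by (simp only: distrib_right sum.distrib)
  then show "(\<lambda>w. f w + g w) \<in> kspan A"
    unfolding kspan_def
    by (intro CollectI exI[of _ "F \<union> G"] exI conjI) (use F(1,2) G(1,2) in auto)
next
  fix b f assume "f \<in> kspan A"
  then obtain F c where F: "finite F" "F \<subseteq> A" "f = (\<lambda>w. \<Sum>a\<in>F. c a * a w)"
    unfolding kspan_def by blast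
  then have "(\<lambda>w. b * f w) = (\<lambda>w. \<Sum>a\<in>F. (b * c a) * a w)"
    by (simp add: sum_distrib_left mult.assoc)
  then show "(\<lambda>w. b * f w) \<in> kspan A"
    unfolding kspan_def by (intro CollectI exI[of _ F] exI conjI) (use F(1,2) in auto)
qed

lemma ksubmodule_supported: "ksubmodule {f. finite {w. f w \<noteq> 0} \<and> (\<forall>w. f w \<noteq> 0 \<longrightarrow> Q w)}"
  unfolding ksubmodule_def
proof (intro conjI ballI allI)
  fix f g :: "'a \<Rightarrow> 'b" and a
  assume f: "f \<in> {f. finite {w. f w \<noteq> 0} \<and> (\<forall>w. f w \<noteq> 0 \<longrightarrow> Q w)}"
  have "finite {w. a * f w \<noteq> 0}"
    by (rule finite_subset[of _ "{w. f w \<noteq> 0}"]) (use f in auto)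
  then show "(\<lambda>w. a * f w) \<in> {f. finite {w. f w \<noteq> 0} \<and> (\<forall>w. f w \<noteq> 0 \<longrightarrow> Q w)}"
    using f by clarsimp (metis mult_zero_right)
  assume g: "g \<in> {f. finite {w. f w \<noteq> 0} \<and> (\<forall>w. f w \<noteq> 0 \<longrightarrow> Q w)}"
  have "finite {w. f w + g w \<noteq> 0}"
    by (rule finite_subset[of _ "{w. f w \<noteq> 0} \<union> {w. g w \<noteq> 0}"]) (use f g in auto)
  then show "(\<lambda>w. f w + g w) \<in> {f. finite {w. f w \<noteq> 0} \<and> (\<forall>w. f w \<noteq> 0 \<longrightarrow> Q w)}"
    using f g by clarsimp (metis add.right_neutral)
qed simp

lemma delta_expand:
  assumes "finite A" "{w. f w \<noteq> 0} \<subseteq> A"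
  shows "f = (\<lambda>v. \<Sum>w\<in>A. f w * delta w v)"
proof
  fix v
  have "(\<Sum>w\<in>A. f w * delta w v) = (\<Sum>w\<in>A. if w = v then f w else 0)"
    by (rule sum.cong) (auto simp: delta_def)
  then show "f v = (\<Sum>w\<in>A. f w * delta w v)"
    using assms by auto
qed

lemma supported_subset:
  assumes "ksubmodule S" "\<And>w. Q w \<Longrightarrow> delta w \<in> S"
    and "finite {w. f w \<noteq> 0}" "\<And>w. f w \<noteq> 0 \<Longrightarrow> Q w"
  shows "f \<in> S"
  by (subst delta_expand[OF assms(3) order_refl]) (rule ksubmodule_sum[OF assms(1)], use assms in auto)

section \<open>The free operated algebra: reduction to words and closure\<close>

lemma ksubmodule_OMod: "ksubmodule (OMod X)"
  unfolding OMod_def by (rule ksubmodule_supported)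

lemma delta_in_OMod [simp]: "wfw X w \<Longrightarrow> delta w \<in> OMod X"
  by (auto simp: OMod_def delta_def)

lemma OMod_subset:
  assumes "ksubmodule S" "\<And>w. wfw X w \<Longrightarrow> delta w \<in> S" shows "OMod X \<subseteq> S"
  using supported_subset[OF assms] by (auto simp: OMod_def)

lemma OMod_linear:
  assumes "flinear L" "ksubmodule S" "\<And>w. wfw X w \<Longrightarrow> L (delta w) \<in> S" "f \<in> OMod X"
  shows "L f \<in> S"
  using OMod_subset[OF ksubmodule_vimage[OF assms(1,2)], of X] assms(3,4) by auto

lemma OMod_bilinear:
  assumes "\<And>g. flinear (\<lambda>f. L f g)" "\<And>f. flinear (\<lambda>g. L f g)" "ksubmodule S"
    and "\<And>u v. wfw X u \<Longrightarrow> wfw X v \<Longrightarrow> L (delta u) (delta v) \<in> S" "f \<in> OMod X" "g \<in> OMod X"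
  shows "L f g \<in> S"
  by (rule OMod_linear[OF assms(1,3) _ assms(5)], rule OMod_linear[OF assms(2,3) _ assms(6)], rule assms(4))

lemma wfw_append: "wfw X u \<Longrightarrow> wfw X v \<Longrightarrow> wfw X (u @ v)"
  and wfw_PL: "wfw X u \<Longrightarrow> wfw X [PL u]"
  and wfw_DL: "wfw X u \<Longrightarrow> wfw X [DL u]"
  by (auto simp: wfw_def intro: wfl.intros)

lemma mmul_in_OMod: "f \<in> OMod X \<Longrightarrow> g \<in> OMod X \<Longrightarrow> mmul f g \<in> OMod X"
  by (rule OMod_bilinear[where L = mmul]) (auto intro: flinear_intros ksubmodule_OMod wfw_append delta_in_OMod)

lemma mP_in_OMod: "f \<in> OMod X \<Longrightarrow> mP f \<in> OMod X"
  by (rule OMod_linear[where L = mP]) (auto intro: flinear_intros ksubmodule_OMod wfw_PL delta_in_OMod)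

lemma mD_in_OMod: "f \<in> OMod X \<Longrightarrow> mD f \<in> OMod X"
  by (rule OMod_linear[where L = mD]) (auto intro: flinear_intros ksubmodule_OMod wfw_DL delta_in_OMod)

text \<open>A context may have an empty side, and \<open>delta []\<close> lies outside
  \<open>OMod\<close>; that case is covered by its being a unit for \<open>mmul\<close>.\<close>

lemma mmul_delta_left_in_OMod:
  "\<forall>a\<in>set l. wfl X a \<Longrightarrow> f \<in> OMod X \<Longrightarrow> mmul (delta l) f \<in> OMod X"
  by (cases "l = []") (auto intro: mmul_in_OMod simp: wfw_def)

lemma mmul_delta_right_in_OMod:
  "\<forall>a\<in>set r. wfl X a \<Longrightarrow> f \<in> OMod X \<Longrightarrow> mmul f (delta r) \<in> OMod X"
  by (cases "r = []") (auto intro: mmul_in_OMod simp: wfw_def)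

lemmas OMod_intros = mmul_in_OMod mP_in_OMod mD_in_OMod
  ksubmodule_msub[OF ksubmodule_OMod] ksubmodule_msmul[OF ksubmodule_OMod]

lemma Spolys_subset_OMod: "Spolys lam X \<subseteq> OMod X"
proof -
  have "rbpoly lam (delta x) (delta y) \<in> OMod X \<and> dpoly lam (delta x) (delta y) \<in> OMod X
      \<and> pdpoly (delta x) \<in> OMod X" if "wfw X x" "wfw X y" for x y
    unfolding rbpoly_def dpoly_def pdpoly_def
    using that by (intro conjI OMod_intros delta_in_OMod)
  then show ?thesis by (auto simp: Spolys_def)
qed

section \<open>Id(S) as an operated ideal\<close>

lemma subst_closed:
  assumes "s \<in> S" "wfc X c"
    and "\<And>l f. \<forall>a\<in>set l. wfl X a \<Longrightarrow> f \<in> S \<Longrightarrow> mmul (delta l) f \<in> S"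
    and "\<And>r f. \<forall>a\<in>set r. wfl X a \<Longrightarrow> f \<in> S \<Longrightarrow> mmul f (delta r) \<in> S"
    and "\<And>f. f \<in> S \<Longrightarrow> mP f \<in> S" "\<And>f. f \<in> S \<Longrightarrow> mD f \<in> S"
  shows "subst c s \<in> S"
  using assms(1,2) by (induction c) (auto intro!: assms(3-6))

text \<open>Induction principle for Id(S): every context is built by multiplying with words on
  either side and by applying P and D, so closure under these four operations catches every
  u|_s.\<close>

lemma IdS_subset:
  assumes "ksubmodule S" "Spolys lam X \<subseteq> S"
    and "\<And>l f. \<forall>a\<in>set l. wfl X a \<Longrightarrow> f \<in> S \<Longrightarrow> mmul (delta l) f \<in> S"
    and "\<And>r f. \<forall>a\<in>set r. wfl X a \<Longrightarrow> f \<in> S \<Longrightarrow> mmul f (delta r) \<in> S"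
    and "\<And>f. f \<in> S \<Longrightarrow> mP f \<in> S" "\<And>f. f \<in> S \<Longrightarrow> mD f \<in> S"
  shows "IdS lam X \<subseteq> S"
  unfolding IdS_def using assms(2)
  by (intro kspan_minimal assms(1)) (auto intro!: subst_closed[where X = X] assms(3-6))

lemma IdS_subset_OMod: "IdS lam X \<subseteq> OMod X"
  by (rule IdS_subset)
     (auto intro: ksubmodule_OMod Spolys_subset_OMod[THEN subsetD] mmul_delta_left_in_OMod
        mmul_delta_right_in_OMod mP_in_OMod mD_in_OMod)

lemma ksubmodule_IdS: "ksubmodule (IdS lam X)"
  unfolding IdS_def by (rule ksubmodule_kspan)

lemma subst_in_IdS: "wfc X c \<Longrightarrow> s \<in> Spolys lam X \<Longrightarrow> subst c s \<in> IdS lam X"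
  unfolding IdS_def by (rule subsetD[OF kspan_superset]) auto

lemma IdS_linear:
  assumes "flinear L" "\<And>c s. wfc X c \<Longrightarrow> s \<in> Spolys lam X \<Longrightarrow> L (subst c s) \<in> IdS lam X"
    and "f \<in> IdS lam X"
  shows "L f \<in> IdS lam X"
proof -
  have "kspan {subst c s | c s. wfc X c \<and> s \<in> Spolys lam X} \<subseteq> {f. L f \<in> IdS lam X}"
    by (intro kspan_minimal ksubmodule_vimage assms(1) ksubmodule_IdS) (use assms(2) in auto)
  then show ?thesis using assms(3) unfolding IdS_def by blast
qed

lemma Spolys_subset_IdS: "Spolys lam X \<subseteq> IdS lam X"
proof
  fix s assume "s \<in> Spolys lam X"
  then show "s \<in> IdS lam X" using subst_in_IdS[of X "Hole [] []" s lam] by simp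
qed

lemma IdS_mmul_delta_left:
  assumes "\<forall>a\<in>set l. wfl X a" "f \<in> IdS lam X" shows "mmul (delta l) f \<in> IdS lam X"
proof (rule IdS_linear[OF flinear_mmul2 _ assms(2)])
  fix c and s :: "'a letter list \<Rightarrow> 'b" assume c: "wfc X c" "s \<in> Spolys lam X"
  \<comment> \<open>The word \<open>l\<close> is absorbed into the outermost left part of the
    context, so the product is again a substitution instance.\<close>
  define c' where "c' = (case c of Hole l' r \<Rightarrow> Hole (l @ l') r
    | CP l' d r \<Rightarrow> CP (l @ l') d r | CD l' d r \<Rightarrow> CD (l @ l') d r)"
  have "mmul (delta l) (subst c s) = subst c' s"
    by (cases c) (simp_all add: c'_def flip: mmul_assoc)
  moreover have "wfc X c'"
    using c assms(1) by (cases c) (auto simp: c'_def)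
  ultimately show "mmul (delta l) (subst c s) \<in> IdS lam X"
    using c by (simp add: subst_in_IdS)
qed

lemma IdS_mmul_delta_right:
  assumes "\<forall>a\<in>set r. wfl X a" "f \<in> IdS lam X" shows "mmul f (delta r) \<in> IdS lam X"
proof (rule IdS_linear[OF flinear_mmul1 _ assms(2)])
  fix c and s :: "'a letter list \<Rightarrow> 'b" assume c: "wfc X c" "s \<in> Spolys lam X"
  define c' where "c' = (case c of Hole l r' \<Rightarrow> Hole l (r' @ r)
    | CP l d r' \<Rightarrow> CP l d (r' @ r) | CD l d r' \<Rightarrow> CD l d (r' @ r))"
  have "mmul (subst c s) (delta r) = subst c' s"
    by (cases c) (simp_all add: c'_def mmul_assoc)
  moreover have "wfc X c'"
    using c assms(1) by (cases c) (auto simp: c'_def)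
  ultimately show "mmul (subst c s) (delta r) \<in> IdS lam X"
    using c by (simp add: subst_in_IdS)
qed

lemma IdS_mP: "f \<in> IdS lam X \<Longrightarrow> mP f \<in> IdS lam X"
proof (erule IdS_linear[OF flinear_mP, rotated])
  fix c and s :: "'a letter list \<Rightarrow> 'b" assume c: "wfc X c" "s \<in> Spolys lam X"
  then show "mP (subst c s) \<in> IdS lam X"
    using subst_in_IdS[of X "CP [] c []" s lam] by simp
qed

lemma IdS_mD: "f \<in> IdS lam X \<Longrightarrow> mD f \<in> IdS lam X"
proof (erule IdS_linear[OF flinear_mD, rotated])
  fix c and s :: "'a letter list \<Rightarrow> 'b" assume c: "wfc X c" "s \<in> Spolys lam X"
  then show "mD (subst c s) \<in> IdS lam X"
    using subst_in_IdS[of X "CD [] c []" s lam] by simp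
qed

lemma IdS_mmul_left: "f \<in> IdS lam X \<Longrightarrow> g \<in> OMod X \<Longrightarrow> mmul g f \<in> IdS lam X"
  by (rule OMod_linear[OF flinear_mmul1 ksubmodule_IdS]) (auto simp: wfw_def intro: IdS_mmul_delta_left)

lemma IdS_mmul_right: "f \<in> IdS lam X \<Longrightarrow> g \<in> OMod X \<Longrightarrow> mmul f g \<in> IdS lam X"
  by (rule OMod_linear[OF flinear_mmul2 ksubmodule_IdS]) (auto simp: wfw_def intro: IdS_mmul_delta_right)

text \<open>The set S imposes the relation on words only; bilinearity extends it to all elements,
  which is what an identity of the quotient requires.\<close>

lemma rbpoly_in_IdS: "f \<in> OMod X \<Longrightarrow> g \<in> OMod X \<Longrightarrow> rbpoly lam f g \<in> IdS lam X"
  by (rule OMod_bilinear[OF flinear_rbpoly1 flinear_rbpoly2 ksubmodule_IdS])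
     (rule Spolys_subset_IdS[THEN subsetD], unfold Spolys_def, blast)

lemma dpoly_in_IdS: "f \<in> OMod X \<Longrightarrow> g \<in> OMod X \<Longrightarrow> dpoly lam f g \<in> IdS lam X"
  by (rule OMod_bilinear[OF flinear_dpoly1 flinear_dpoly2 ksubmodule_IdS])
     (rule Spolys_subset_IdS[THEN subsetD], unfold Spolys_def, blast)

lemma pdpoly_in_IdS: "f \<in> OMod X \<Longrightarrow> pdpoly f \<in> IdS lam X"
  by (rule OMod_linear[OF flinear_pdpoly ksubmodule_IdS])
     (rule Spolys_subset_IdS[THEN subsetD], unfold Spolys_def, blast)

section \<open>Evaluation and the universal property\<close>

text \<open>The product is a parameter instead of the class operation, because the locale is
  interpreted both in types of class \<open>ring\<close> and in the model, whose product depends on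
  the value \<open>lam\<close>.\<close>

locale ldrb_algebra = module sm
  for sm :: "'k::comm_ring_1 \<Rightarrow> 'r::ab_group_add \<Rightarrow> 'r" +
  fixes lam :: 'k and mul :: "'r \<Rightarrow> 'r \<Rightarrow> 'r" and P D :: "'r \<Rightarrow> 'r"
  assumes mul_add_left: "mul (x + y) z = mul x z + mul y z"
    and mul_add_right: "mul z (x + y) = mul z x + mul z y"
    and mul_sm_left: "mul (sm a x) y = sm a (mul x y)"
    and mul_sm_right: "mul x (sm a y) = sm a (mul x y)"
    and mul_assoc: "mul (mul x y) z = mul x (mul y z)"
    and P_add: "P (x + y) = P x + P y" and P_sm: "P (sm a x) = sm a (P x)"
    and D_add: "D (x + y) = D x + D y" and D_sm: "D (sm a x) = sm a (D x)"
    and rota_baxter: "mul (P x) (P y) = P (mul x (P y)) + P (mul (P x) y) + sm lam (P (mul x y))"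
    and leibniz: "D (mul x y) = mul (D x) y + mul x (D y) + sm lam (mul (D x) (D y))"
    and D_P: "D (P x) = x"
begin

text \<open>Linearity is confined to \<open>OMod\<close>: additivity of \<open>evalf\<close> rests
  on finite supports, and \<open>qhom\<close> does not constrain a map elsewhere.\<close>

definition olinear :: "'x set \<Rightarrow> (('x letter list \<Rightarrow> 'k) \<Rightarrow> 'r) \<Rightarrow> bool" where
  "olinear X L \<longleftrightarrow> (\<forall>f\<in>OMod X. \<forall>g\<in>OMod X. L (\<lambda>w. f w + g w) = L f + L g) \<and>
     (\<forall>a. \<forall>f\<in>OMod X. L (\<lambda>w. a * f w) = sm a (L f))"

lemma olinear_zero:
  assumes "olinear X L" shows "L (\<lambda>w. 0) = 0"
proof -
  have "L (\<lambda>w. 0 * f w) = sm 0 (L f)" if "f \<in> OMod X" for f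
    using assms that by (simp only: olinear_def)
  from this[OF ksubmodule_zero[OF ksubmodule_OMod]] show ?thesis by simp
qed

lemma ksubmodule_equalizer:
  assumes "olinear X L" "olinear X M" shows "ksubmodule {f \<in> OMod X. L f = M f}"
  using assms ksubmodule_OMod[of X, where 'b = 'k] olinear_zero[OF assms(1)] olinear_zero[OF assms(2)]
  unfolding ksubmodule_def olinear_def by auto

lemma olinear_ext:
  assumes "olinear X L" "olinear X M" "\<And>w. wfw X w \<Longrightarrow> L (delta w) = M (delta w)" "f \<in> OMod X"
  shows "L f = M f"
  using OMod_subset[OF ksubmodule_equalizer[OF assms(1,2)], of X] assms(3,4) by auto

lemma olinear_comp:
  assumes "olinear X L" "flinear M" "\<And>f. f \<in> OMod X \<Longrightarrow> M f \<in> OMod X"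
  shows "olinear X (\<lambda>f. L (M f))"
  using assms by (simp add: olinear_def flinear_def)

lemma olinear_mul_left: "olinear X L \<Longrightarrow> olinear X (\<lambda>f. mul (L f) c)"
  and olinear_mul_right: "olinear X L \<Longrightarrow> olinear X (\<lambda>f. mul c (L f))"
  and olinear_P: "olinear X L \<Longrightarrow> olinear X (\<lambda>f. P (L f))"
  and olinear_D: "olinear X L \<Longrightarrow> olinear X (\<lambda>f. D (L f))"
  by (simp_all add: olinear_def mul_add_left mul_add_right mul_sm_left mul_sm_right P_add P_sm D_add D_sm)

text \<open>Target algebras need not have a unit, so the recursion stops at one factor; the value 0
  of the empty product is a dummy, excluded by the nonemptiness assumptions of
  \<open>nprod_append\<close>.\<close>

fun nprod :: "'r list \<Rightarrow> 'r" where
  "nprod [] = 0"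
| "nprod [a] = a"
| "nprod (a # b # as) = mul a (nprod (b # as))"

lemma nprod_append: "as \<noteq> [] \<Longrightarrow> bs \<noteq> [] \<Longrightarrow> nprod (as @ bs) = mul (nprod as) (nprod bs)"
proof (induction as rule: nprod.induct)
  case (2 a)
  then show ?case by (cases bs) auto
qed (simp_all add: mul_assoc)

primrec evl :: "('x \<Rightarrow> 'r) \<Rightarrow> 'x letter \<Rightarrow> 'r" where
  "evl e (V x) = e x"
| "evl e (PL u) = P (nprod (map (evl e) u))"
| "evl e (DL u) = D (nprod (map (evl e) u))"

definition evw :: "('x \<Rightarrow> 'r) \<Rightarrow> 'x letter list \<Rightarrow> 'r" where
  "evw e w = nprod (map (evl e) w)"

lemma evw_append: "u \<noteq> [] \<Longrightarrow> v \<noteq> [] \<Longrightarrow> evw e (u @ v) = mul (evw e u) (evw e v)"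
  by (simp add: evw_def nprod_append)

lemma evw_V [simp]: "evw e [V x] = e x"
  and evw_PL [simp]: "evw e [PL u] = P (evw e u)"
  and evw_DL [simp]: "evw e [DL u] = D (evw e u)"
  by (simp_all add: evw_def)

definition evalf :: "('x \<Rightarrow> 'r) \<Rightarrow> ('x letter list \<Rightarrow> 'k) \<Rightarrow> 'r" where
  "evalf e f = (\<Sum>w\<in>{w. f w \<noteq> 0}. sm (f w) (evw e w))"

lemma evalf_superset:
  assumes "finite A" "{w. f w \<noteq> 0} \<subseteq> A"
  shows "evalf e f = (\<Sum>w\<in>A. sm (f w) (evw e w))"
  unfolding evalf_def by (rule sum.mono_neutral_left) (use assms in auto)

lemma olinear_evalf: "olinear X (evalf e)"
  unfolding olinear_def
proof (intro conjI ballI allI)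
  fix f g :: "'a letter list \<Rightarrow> 'k" and a :: 'k assume f: "f \<in> OMod X" 
  then have "evalf e (\<lambda>w. a * f w) = (\<Sum>w\<in>{w. f w \<noteq> 0}. sm (a * f w) (evw e w))"
    by (intro evalf_superset) (auto simp: OMod_def)
  then show "evalf e (\<lambda>w. a * f w) = sm a (evalf e f)"
    by (simp add: evalf_def scale_sum_right)
  assume g: "g \<in> OMod X"
  let ?A = "{w. f w \<noteq> 0} \<union> {w. g w \<noteq> 0}"
  have A: "finite ?A" using f g by (auto simp: OMod_def)
  show "evalf e (\<lambda>w. f w + g w) = evalf e f + evalf e g"
    by (subst (1 2 3) evalf_superset[OF A]) (auto simp: scale_left_distrib sum.distrib)
qed

lemma evalf_delta [simp]: "evalf e (delta w) = evw e w"
  by (subst evalf_superset[of "{w}"]) (auto simp: delta_def)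

lemma evalf_mmul:
  assumes "f \<in> OMod X" "g \<in> OMod X"
  shows "evalf e (mmul f g) = mul (evalf e f) (evalf e g)"
proof -
  note evl = olinear_evalf[of X e]
  have *: "evalf e (mmul (delta u) g) = mul (evalf e (delta u)) (evalf e g)" if "wfw X u" for u
    by (rule olinear_ext[OF olinear_comp[OF evl flinear_mmul2] olinear_mul_right[OF evl] _ assms(2)])
       (use that in \<open>auto simp: wfw_def evw_append intro: mmul_in_OMod\<close>)
  show ?thesis
    by (rule olinear_ext[OF olinear_comp[OF evl flinear_mmul1] olinear_mul_left[OF evl] _ assms(1)])
       (use assms * in \<open>auto intro: mmul_in_OMod\<close>)
qed

lemma evalf_mP: "f \<in> OMod X \<Longrightarrow> evalf e (mP f) = P (evalf e f)"
  by (rule olinear_ext[OF olinear_comp[OF olinear_evalf flinear_mP] olinear_P[OF olinear_evalf]])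
     (auto intro: mP_in_OMod)

lemma evalf_mD: "f \<in> OMod X \<Longrightarrow> evalf e (mD f) = D (evalf e f)"
  by (rule olinear_ext[OF olinear_comp[OF olinear_evalf flinear_mD] olinear_D[OF olinear_evalf]])
     (auto intro: mD_in_OMod)

lemma evalf_madd: "f \<in> OMod X \<Longrightarrow> g \<in> OMod X \<Longrightarrow> evalf e (madd f g) = evalf e f + evalf e g"
  and evalf_msmul: "f \<in> OMod X \<Longrightarrow> evalf e (msmul a f) = sm a (evalf e f)"
  using olinear_evalf[of X e] by (simp_all add: olinear_def madd_def msmul_def)

lemma evalf_msub:
  assumes "f \<in> OMod X" "g \<in> OMod X" shows "evalf e (msub f g) = evalf e f - evalf e g"
proof -
  have "msub f g = madd f (msmul (-1) g)" by (simp add: msub_def madd_def msmul_def)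
  then show ?thesis
    using assms by (simp add: evalf_madd[of _ X] evalf_msmul[of _ X] ksubmodule_msmul[OF ksubmodule_OMod])
qed

lemma mul_zero_left: "mul 0 x = 0" and mul_zero_right: "mul x 0 = 0"
  and P_zero: "P 0 = 0" and D_zero: "D 0 = 0"
  using mul_sm_left[of 0 0 x] mul_sm_right[of x 0 0] P_sm[of 0 0] D_sm[of 0 0] by simp_all

lemma evalf_Spolys:
  assumes "s \<in> Spolys lam X" shows "evalf e s = 0"
proof -
  have "evalf e (rbpoly lam (delta x) (delta y)) = 0 \<and> evalf e (dpoly lam (delta x) (delta y)) = 0
      \<and> evalf e (pdpoly (delta x)) = 0" if xy: "wfw X x" "wfw X y" for x y
  proof -
    have "x \<noteq> []" "y \<noteq> []" using xy by (auto simp: wfw_def)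
    note ne = evw_append[of x y, OF this] evw_append[of x "[_]"] evw_append[of "[_]" y]
      evw_append[of "[_]" "[_]"]
    show ?thesis
      unfolding rbpoly_def dpoly_def pdpoly_def
      by (intro conjI; (subst evalf_msub[of _ X] evalf_msmul[of _ X],
            (intro OMod_intros delta_in_OMod xy)[1], (intro OMod_intros delta_in_OMod xy)?)+)
         (use \<open>x \<noteq> []\<close> \<open>y \<noteq> []\<close> in \<open>simp_all add: ne evw_append[of x y] rota_baxter leibniz D_P
             del: append.simps\<close>)
  qed
  then show ?thesis using assms by (auto simp: Spolys_def)
qed

text \<open>The kernel of evaluation meets the closure conditions of \<open>IdS_subset\<close>. It
  is intersected with \<open>OMod\<close> because multiplicativity and compatibility with P and D
  are established there.\<close>

lemma evalf_IdS:
  assumes "f \<in> IdS lam X" shows "evalf e f = 0"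
proof -
  have "olinear X (\<lambda>f. 0)" by (simp add: olinear_def)
  note sub = ksubmodule_equalizer[OF olinear_evalf this]
  have left: "evalf e (mmul (delta l) f) = 0"
    if "\<forall>a\<in>set l. wfl X a" "f \<in> OMod X" "evalf e f = 0" for l f
    by (cases "l = []") (use that evalf_mmul[of "delta l" X f] in \<open>auto simp: wfw_def mul_zero_right\<close>)
  have right: "evalf e (mmul f (delta r)) = 0"
    if "\<forall>a\<in>set r. wfl X a" "f \<in> OMod X" "evalf e f = 0" for r f
    by (cases "r = []") (use that evalf_mmul[of f X "delta r"] in \<open>auto simp: wfw_def mul_zero_left\<close>)
  have "IdS lam X \<subseteq> {f \<in> OMod X. evalf e f = 0}"
    by (rule IdS_subset[OF sub])
       (use Spolys_subset_OMod evalf_Spolys in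
         \<open>auto simp: left right evalf_mP[of _ X] evalf_mD[of _ X] P_zero D_zero
           intro: mmul_delta_left_in_OMod mmul_delta_right_in_OMod mP_in_OMod mD_in_OMod\<close>)
  then show ?thesis using assms by auto
qed

lemma evalf_unique:
  assumes psi: "olinear X psi" "\<And>f g. f \<in> OMod X \<Longrightarrow> g \<in> OMod X \<Longrightarrow> psi (mmul f g) = mul (psi f) (psi g)"
    "\<And>f. f \<in> OMod X \<Longrightarrow> psi (mP f) = P (psi f)" "\<And>f. f \<in> OMod X \<Longrightarrow> psi (mD f) = D (psi f)"
    "\<And>x. x \<in> X \<Longrightarrow> psi (delta [V x]) = e x"
    and "f \<in> OMod X"
  shows "psi f = evalf e f"
proof (rule olinear_ext[OF psi(1) olinear_evalf _ assms(6)])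
  \<comment> \<open>Conditional on the letters, so that the induction over letters that follows can
    apply it to the argument of P(u) and D(u).\<close>
  have word: "psi (delta w) = evw e w"
    if "w \<noteq> []" "\<forall>a\<in>set w. wfl X a \<and> psi (delta [a]) = evw e [a]" for w
    using that
  proof (induction w rule: list_nonempty_induct)
    case (cons a w)
    then have "delta [a] \<in> OMod X" "delta w \<in> OMod X" by (auto simp: wfw_def)
    then have "psi (mmul (delta [a]) (delta w)) = mul (psi (delta [a])) (psi (delta w))" by (rule psi(2))
    then show ?case using cons evw_append[of "[a]" w e] by simp
  qed simp
  have letter: "psi (delta [a]) = evw e [a]" if "wfl X a" for a
    using that
  proof (induction rule: wfl.induct)
    case (wfl_P u)
    then have "wfw X u" by (auto simp: wfw_def)
    then have "psi (mP (delta u)) = P (psi (delta u))" by (intro psi(3)) simp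
    then show ?case using wfl_P word[of u] by simp
  next
    case (wfl_D u)
    then have "wfw X u" by (auto simp: wfw_def)
    then have "psi (mD (delta u)) = D (psi (delta u))" by (intro psi(4)) simp
    then show ?case using wfl_D word[of u] by simp
  qed (simp add: psi(5))
  show "psi (delta w) = evalf e (delta w)" if "wfw X w" for w
    using that word[of w] letter by (simp add: wfw_def)
qed

end

lemma ldrb_algebra_if_ldrb:
  assumes "ldrb sm lam P D" shows "ldrb_algebra sm lam (*) P D"
proof -
  have "kalg sm" "klinear sm P" "klinear sm D" using assms by (simp_all add: ldrb_def)
  then interpret module sm by unfold_locales (simp_all add: kalg_def)
  have sm: "sm a x * y = sm a (x * y)" "x * sm a y = sm a (x * y)" for a x y
    using \<open>kalg sm\<close> unfolding kalg_def by metis+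
  have "P x * P y = P (x * P y) + P (P x * y) + sm lam (P (x * y))"
    "D (x * y) = D x * y + x * D y + sm lam (D x * D y)" "D (P x) = x" for x y
    using assms unfolding ldrb_def by blast+
  with sm \<open>klinear sm P\<close> \<open>klinear sm D\<close> show ?thesis
    by unfold_locales (simp_all add: klinear_def distrib_right distrib_left mult.assoc)
qed

lemma ldrb_universal:
  fixes sm :: "'k::comm_ring_1 \<Rightarrow> 'r::ring \<Rightarrow> 'r" and X :: "'b set"
  assumes "ldrb sm lam P D"
  shows "\<exists>phi. qhom X (IdS lam X) sm P D e phi \<and>
           (\<forall>psi. qhom X (IdS lam X) sm P D e psi \<longrightarrow> (\<forall>f\<in>OMod X. psi f = phi f))"
proof -
  interpret ldrb_algebra sm lam "(*)" P D by (rule ldrb_algebra_if_ldrb[OF assms])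
  show ?thesis
  proof (intro exI[of _ "evalf e"] conjI allI impI ballI)
    show "qhom X (IdS lam X) sm P D e (evalf e)"
      by (simp add: qhom_def evalf_madd[of _ X] evalf_msmul[of _ X] evalf_mmul[of _ X] evalf_mP[of _ X]
          evalf_mD[of _ X] evalf_IdS)
    fix psi :: "('b letter list \<Rightarrow> 'k) \<Rightarrow> 'r" and f :: "'b letter list \<Rightarrow> 'k"
    assume "qhom X (IdS lam X) sm P D e psi" "f \<in> OMod X"
    then show "psi f = evalf e f"
      by (intro evalf_unique[of X]) (simp_all add: qhom_def olinear_def madd_def msmul_def)
  qed
qed

section \<open>Normal words and spanning\<close>

fun isPL :: "'x letter \<Rightarrow> bool" where
  "isPL (PL u) = True"
| "isPL a = False"

abbreviation noPP :: "'x letter list \<Rightarrow> bool" where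
  "noPP \<equiv> successively (\<lambda>a b. isPL a \<longrightarrow> \<not> isPL b)"

inductive nfl :: "'x set \<Rightarrow> 'x letter \<Rightarrow> bool" for X :: "'x set" where
  nfl_Dpow: "x \<in> X \<Longrightarrow> nfl X (Dpow i x)"
| nfl_PL: "z \<noteq> [] \<Longrightarrow> \<forall>a\<in>set z. nfl X a \<Longrightarrow> noPP z \<Longrightarrow> nfl X (PL z)"

definition nfw :: "'x set \<Rightarrow> 'x letter list \<Rightarrow> bool" where
  "nfw X w \<longleftrightarrow> w \<noteq> [] \<and> (\<forall>a\<in>set w. nfl X a) \<and> noPP w"

lemma isPL_Dpow [simp]: "\<not> isPL (Dpow i x)"
  by (cases i) auto

lemma Dpow_neq_PL [simp]: "Dpow i x \<noteq> PL z" "PL z \<noteq> Dpow i x"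
  by (cases i; simp)+

lemma nfl_PL_iff [simp]: "nfl X (PL z) \<longleftrightarrow> nfw X z"
  by (auto simp: nfw_def elim: nfl.cases intro: nfl_PL)

lemma nfl_cases':
  assumes "nfl X a"
  obtains (gen) i x where "x \<in> X" "a = Dpow i x" | (op) z where "nfw X z" "a = PL z"
  using assms by cases (auto simp: nfw_def)

lemma isPL_iff: "isPL a \<longleftrightarrow> (\<exists>z. a = PL z)"
  by (cases a) auto

section \<open>Normal words are the elements of Phi(D^omega(X))\<close>

lemma sgrp_Domega: "sgrp (Domega X) = {w. w \<noteq> [] \<and> (\<forall>a\<in>set w. \<exists>i x. x \<in> X \<and> a = Dpow i x)}"
proof (intro equalityI subsetI)
  fix w assume "w \<in> sgrp (Domega X)"
  then obtain ys where ys: "w = concat ys" "ys \<noteq> []" "set ys \<subseteq> Domega X"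
    unfolding sgrp_def by auto
  then have "w \<noteq> []" by (cases ys) (auto simp: Domega_def)
  with ys show "w \<in> {w. w \<noteq> [] \<and> (\<forall>a\<in>set w. \<exists>i x. x \<in> X \<and> a = Dpow i x)}"
    by (fastforce simp: Domega_def)
next
  fix w assume "w \<in> {w. w \<noteq> [] \<and> (\<forall>a\<in>set w. \<exists>i x. x \<in> X \<and> a = Dpow i x)}"
  moreover have "concat (map (\<lambda>a. [a]) w) = w" by simp
  ultimately show "w \<in> sgrp (Domega X)"
    unfolding sgrp_def by (intro CollectI exI[of _ "map (\<lambda>a. [a]) w"]) (fastforce simp: Domega_def)
qed

lemma noPP_if_no_PL: "\<forall>a\<in>set w. \<not> isPL a \<Longrightarrow> noPP w"
  by (induction w) (auto simp: successively_Cons)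

lemma setcat_assoc: "setcat (setcat A B) C = setcat A (setcat B C)"
  by (auto simp: setcat_def) (metis append_assoc)+

lemma setcat_Nil [simp]: "setcat {[]} A = A" "setcat A {[]} = A"
  by (auto simp: setcat_def)

lemma setcatI: "a \<in> A \<Longrightarrow> b \<in> B \<Longrightarrow> a @ b \<in> setcat A B"
  by (auto simp: setcat_def)

lemma setcat_Cons:
  assumes "w \<in> setcat A B" "\<And>a. a \<in> A \<Longrightarrow> g # a \<in> A'" shows "g # w \<in> setcat A' B"
proof -
  obtain a b where "w = a @ b" "a \<in> A" "b \<in> B" using assms(1) by (auto simp: setcat_def)
  then show ?thesis using setcatI[of "g # a" A' b B] assms(2) by simp
qed

lemma setcat_mono: "A \<subseteq> A' \<Longrightarrow> B \<subseteq> B' \<Longrightarrow> setcat A B \<subseteq> setcat A' B'"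
  by (auto simp: setcat_def)

lemma spow_mono: "A \<subseteq> A' \<Longrightarrow> spow A r \<subseteq> spow A' r"
  by (induction r) (auto intro: setcat_mono[THEN subsetD])

text \<open>A(BA)^r = (AB)^r A. With it, each of the four families in \<open>LamP\<close> can be
  rebracketed so that its first factor stands alone.\<close>

lemma spow_shift: "setcat A (spow (setcat B A) r) = setcat (spow (setcat A B) r) A"
  by (induction r) (simp_all add: setcat_assoc)

lemma spow_Suc_right: "spow A (Suc r) = setcat (spow A r) A"
  using spow_shift[of A "{[]}" r] by simp

lemma PZ_mono: "Z \<subseteq> Z' \<Longrightarrow> PZ Z \<subseteq> PZ Z'"
  by (auto simp: PZ_def)

lemma LamP_mono: "Z \<subseteq> Z' \<Longrightarrow> LamP Y Z \<subseteq> LamP Y Z'"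
  unfolding LamP_def by (intro Un_mono UN_mono subset_refl spow_mono setcat_mono PZ_mono)

lemma LamP_cases:
  assumes "w \<in> LamP Y Z"
  obtains (YP) r where "w \<in> spow (setcat Y (PZ Z)) (Suc r)"
    | (YPY) r where "w \<in> setcat (spow (setcat Y (PZ Z)) r) Y"
    | (PY) r where "w \<in> spow (setcat (PZ Z) Y) (Suc r)"
    | (PYP) r where "w \<in> setcat (spow (setcat (PZ Z) Y) r) (PZ Z)"
proof -
  have "r \<in> {1..} \<longleftrightarrow> (\<exists>q. r = Suc q)" for r :: nat by (cases r) auto
  then show ?thesis using assms that unfolding LamP_def by (auto simp del: spow.simps)
qed

lemma LamP_YP: "w \<in> spow (setcat Y (PZ Z)) (Suc r) \<Longrightarrow> w \<in> LamP Y Z"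
  and LamP_YPY: "w \<in> setcat (spow (setcat Y (PZ Z)) r) Y \<Longrightarrow> w \<in> LamP Y Z"
  and LamP_PY: "w \<in> spow (setcat (PZ Z) Y) (Suc r) \<Longrightarrow> w \<in> LamP Y Z"
  and LamP_PYP: "w \<in> setcat (spow (setcat (PZ Z) Y) r) (PZ Z) \<Longrightarrow> w \<in> LamP Y Z"
  unfolding LamP_def by (fastforce simp del: spow.simps)+

lemma subset_LamP: "Y \<subseteq> LamP Y Z"
  using LamP_YPY[of _ Y Z 0] by auto

lemma Phi_Suc_mono: "Phi X n \<subseteq> Phi X (Suc n)"
  by (induction n) (simp_all add: subset_LamP LamP_mono)

lemma Phi_mono: "n \<le> m \<Longrightarrow> Phi X n \<subseteq> Phi X m"
  by (rule lift_Suc_mono_le[of "Phi X"]) (rule Phi_Suc_mono)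

lemma nfw_PL: "nfw X [PL z] \<longleftrightarrow> nfw X z"
  by (subst nfw_def) simp

lemma Phi_subset_nfw: "Phi X n \<subseteq> Collect (nfw X)"
proof (induction n)
  case 0
  show ?case by (fastforce simp: sgrp_Domega nfw_def intro!: noPP_if_no_PL intro: nfl_Dpow)
next
  case (Suc n)
  define Y where "Y = sgrp (Domega X)"
  define P where "P = PZ (Phi X n)"
  \<comment> \<open>\<open>G\<close> is stable under left multiplication by YP(Z). It contains the
    empty word to start from the power 0, and its words do not begin with a P-letter, so that P(z)
    may be put in front.\<close>
  define G where "G = {w. w = [] \<or> nfw X w \<and> \<not> isPL (hd w)}"
  have Y: "w \<noteq> []" "\<forall>a\<in>set w. nfl X a \<and> \<not> isPL a" if "w \<in> Y" for w
    using that by (auto simp: Y_def sgrp_Domega intro: nfl_Dpow)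
  have YG: "Y \<subseteq> G"
    using Y by (auto simp: G_def nfw_def intro!: noPP_if_no_PL)
  have P: "\<exists>z. w = [PL z] \<and> nfw X z" if "w \<in> P" for w
    using that Suc.IH by (auto simp: P_def PZ_def)
  have YPG: "setcat (setcat Y P) G \<subseteq> G"
  proof
    fix w assume "w \<in> setcat (setcat Y P) G"
    then obtain y z g where w: "w = y @ [PL z] @ g" and "y \<in> Y" and z: "nfw X z" and g: "g \<in> G"
      using P unfolding setcat_def by force
    note y = Y[OF \<open>y \<in> Y\<close>]
    then have "noPP y" by (intro noPP_if_no_PL) auto
    with w y z g show "w \<in> G"
      by (auto simp: G_def nfw_def successively_append_iff successively_Cons)
  qed
  have YPrG: "setcat (spow (setcat Y P) r) G \<subseteq> G" for r
  proof (induction r)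
    case (Suc r)
    then show ?case
      using setcat_mono[OF order_refl Suc, of "setcat Y P"] YPG by (simp add: setcat_assoc)
  qed simp
  have YPr: "spow (setcat Y P) r \<subseteq> G" for r
    using YPrG[of r] setcat_mono[of "spow (setcat Y P) r" "spow (setcat Y P) r" "{[]}" G]
    by (auto simp: G_def)
  have PG: "setcat P G \<subseteq> Collect (nfw X)"
    using P by (fastforce simp: setcat_def G_def nfw_def successively_Cons)
  have ne: "[] \<notin> setcat A Y" "[] \<notin> setcat (setcat Y P) A" for A
    using Y(1) by (auto simp: setcat_def)
  have G: "w \<in> G \<Longrightarrow> w \<noteq> [] \<Longrightarrow> nfw X w" for w by (auto simp: G_def)
  show ?case
  proof
    fix w assume "w \<in> Phi X (Suc n)"
    then have "w \<in> LamP Y (Phi X n)" by (simp add: Y_def)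
    then show "w \<in> Collect (nfw X)"
    proof (cases rule: LamP_cases)
      case (YP r)
      then have "w \<in> G" "w \<noteq> []" using YPr[of "Suc r"] ne(2) by (auto simp: P_def)
      then show ?thesis using G by simp
    next
      case (YPY r)
      then have "w \<in> G" "w \<noteq> []"
        using YPrG[of r] setcat_mono[OF order_refl YG] ne(1) by (auto simp: P_def)
      then show ?thesis using G by simp
    next
      case (PY r)
      \<comment> \<open>(PY)^(r+1) = P(YP)^r Y: one P-letter in front of a word of
        \<open>G\<close>.\<close>
      then have "w \<in> setcat P (setcat (spow (setcat Y P) r) Y)"
        by (simp add: P_def setcat_assoc flip: spow_shift)
      also have "\<dots> \<subseteq> setcat P G"
        using YPrG[of r] setcat_mono[OF order_refl YG] by (intro setcat_mono) blast+
      finally show ?thesis using PG by blast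
    next
      case (PYP r)
      then have "w \<in> setcat P (spow (setcat Y P) r)"
        by (simp add: P_def spow_shift)
      also have "\<dots> \<subseteq> setcat P G"
        using YPr by (intro setcat_mono) auto
      finally show ?thesis using PG by blast
    qed
  qed
qed

text \<open>The new letter either lengthens the first Y-factor, staying in its family, or starts a
  new Y-factor before a P-letter. In the latter case (PY)^(r+1) becomes (YP)^(r+1) Y, and (PY)^r P
  becomes (YP)^(r+1).\<close>

lemma LamP_Cons_gen:
  assumes w: "w \<in> LamP Y Z" and g: "[g] \<in> Y" "\<And>y. y \<in> Y \<Longrightarrow> g # y \<in> Y"
  shows "g # w \<in> LamP Y Z"
  using w
proof (cases rule: LamP_cases)
  case (YP r)
  then have "g # w \<in> spow (setcat Y (PZ Z)) (Suc r)"
    unfolding spow.simps by (elim setcat_Cons g(2))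
  then show ?thesis by (rule LamP_YP)
next
  case (YPY r)
  then have "g # w \<in> setcat (spow (setcat Y (PZ Z)) r) Y"
  proof (cases r)
    case 0
    with YPY g(2) show ?thesis by simp
  next
    case (Suc q)
    with YPY show ?thesis unfolding Suc spow.simps by (elim setcat_Cons g(2))
  qed
  then show ?thesis by (rule LamP_YPY)
next
  case (PY r)
  then have "[g] @ w \<in> setcat Y (spow (setcat (PZ Z) Y) (Suc r))"
    using g(1) by (intro setcatI)
  then show ?thesis using LamP_YPY[of "g # w" Y Z "Suc r"] by (simp only: spow_shift append.simps)
next
  case (PYP r)
  then have "[g] @ w \<in> setcat Y (setcat (spow (setcat (PZ Z) Y) r) (PZ Z))"
    using g(1) by (intro setcatI)
  then have "g # w \<in> spow (setcat Y (PZ Z)) (Suc r)"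
    unfolding spow_Suc_right by (simp add: spow_shift flip: setcat_assoc)
  then show ?thesis by (rule LamP_YP)
qed

text \<open>The condition on the head leaves the two families that begin with Y: (YP)^(r+1) becomes
  (PY)^(r+1) P, and (YP)^r Y becomes (PY)^(r+1).\<close>

lemma LamP_Cons_PL:
  assumes w: "w \<in> LamP Y Z" and z: "z \<in> Z" and "\<not> isPL (hd w)"
  shows "PL z # w \<in> LamP Y Z"
proof -
  have P: "[PL z] \<in> PZ Z" using z by (auto simp: PZ_def)
  from w show ?thesis
  proof (cases rule: LamP_cases)
    case (YP r)
    then have "[PL z] @ w \<in> setcat (PZ Z) (spow (setcat Y (PZ Z)) (Suc r))"
      using P by (intro setcatI)
    then show ?thesis using LamP_PYP[of "PL z # w" Z Y "Suc r"] by (simp only: spow_shift append.simps)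
  next
    case (YPY r)
    then have "[PL z] @ w \<in> setcat (PZ Z) (setcat (spow (setcat Y (PZ Z)) r) Y)"
      using P by (intro setcatI)
    then have "PL z # w \<in> spow (setcat (PZ Z) Y) (Suc r)"
      unfolding spow_Suc_right by (simp add: spow_shift flip: setcat_assoc)
    then show ?thesis by (rule LamP_PY)
  next
    case (PY r)
    then have "isPL (hd w)" by (auto simp: setcat_def PZ_def)
    then show ?thesis using assms(3) by simp
  next
    case (PYP r)
    then have "isPL (hd w)" by (cases r) (auto simp: setcat_def PZ_def)
    then show ?thesis using assms(3) by simp
  qed
qed

lemma nfw_Cons: "w \<noteq> [] \<Longrightarrow>
    nfw X (a # w) \<longleftrightarrow> nfl X a \<and> nfw X w \<and> \<not> (isPL a \<and> isPL (hd w))"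
  by (auto simp: nfw_def successively_Cons)

text \<open>The measure adds up the sizes of the letters, so it drops both for the tail of a word
  and for the argument of a P-letter.\<close>

lemma nfw_in_Phi: "nfw X w \<Longrightarrow> \<exists>n. w \<in> Phi X n"
proof (induction "size_list size w" arbitrary: w rule: less_induct)
  case less
  have PL: "\<exists>n. z \<in> Phi X n" if "PL z \<in> set w" for z
  proof (rule less.hyps)
    have "size (PL z) \<le> size_list size w" using that by (rule size_list_estimation') simp
    then show "size_list size z < size_list size w" by simp
    show "nfw X z" using less.prems that nfl_PL_iff[of X z] unfolding nfw_def[of X w] by blast
  qed
  show ?case
  proof (cases w)
    case Nil
    then show ?thesis using less.prems by (simp add: nfw_def)
  next
    case (Cons a w')
    then have "nfl X a" using less.prems by (simp add: nfw_def)
    show ?thesis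
    proof (cases "w' = []")
      case True
      from \<open>nfl X a\<close> show ?thesis
      proof (cases rule: nfl_cases')
        case (gen i x)
        then have "w \<in> Phi X 0" using Cons True by (auto simp: sgrp_Domega)
        then show ?thesis ..
      next
        case (op z)
        then obtain n where "z \<in> Phi X n" using PL[of z] Cons by auto
        then have "w \<in> setcat (spow (setcat (PZ (Phi X n)) (sgrp (Domega X))) 0) (PZ (Phi X n))"
          using Cons True op by (auto simp: PZ_def)
        then have "w \<in> Phi X (Suc n)" unfolding Phi.simps by (rule LamP_PYP)
        then show ?thesis ..
      qed
    next
      case False
      have w': "nfw X w'" "\<not> (isPL a \<and> isPL (hd w'))"
        using less.prems nfw_Cons[OF False] Cons by auto
      then obtain m where m: "w' \<in> Phi X m"
        using less.hyps[of w'] Cons by auto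
      from \<open>nfl X a\<close> show ?thesis
      proof (cases rule: nfl_cases')
        case (gen i x)
        \<comment> \<open>The level \<open>m\<close> may be 0, where \<open>Phi\<close> is not given
          by \<open>LamP\<close>; one level up it is.\<close>
        have "w' \<in> Phi X (Suc m)" using m Phi_Suc_mono by blast
        then have "a # w' \<in> Phi X (Suc m)"
          unfolding Phi.simps by (rule LamP_Cons_gen) (use gen in \<open>auto simp: sgrp_Domega\<close>)
        then show ?thesis using Cons by blast
      next
        case (op z)
        then obtain n where "z \<in> Phi X n" using PL[of z] Cons by auto
        \<comment> \<open>The argument of P has to lie exactly one level below the tail, so both are
          lifted to matching levels.\<close>
        then have "z \<in> Phi X (max n m)" "w' \<in> Phi X (Suc (max n m))"
          using m Phi_mono[of n "max n m" X] Phi_mono[of m "max n m" X] Phi_Suc_mono[of X "max n m"]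
          by (auto simp del: Phi.simps)
        then have "a # w' \<in> Phi X (Suc (max n m))"
          using w'(2) op unfolding Phi.simps by (auto intro: LamP_Cons_PL)
        then show ?thesis using Cons by blast
      qed
    qed
  qed
qed

lemma PhiD_eq_nfw: "PhiD X = Collect (nfw X)"
  unfolding PhiD_def using Phi_subset_nfw nfw_in_Phi by fast

section \<open>Normal words span modulo Id(S)\<close>

lemma wfl_Dpow: "x \<in> X \<Longrightarrow> wfl X (Dpow i x)"
  by (induction i) (auto intro: wfl.intros)

lemma nfl_wfl: "nfl X a \<Longrightarrow> wfl X a"
  by (induction rule: nfl.induct) (auto intro: wfl.intros wfl_Dpow)

lemma nfw_wfw: "nfw X w \<Longrightarrow> wfw X w"
  by (auto simp: nfw_def wfw_def nfl_wfl)

text \<open>The preimage in \<open>OMod\<close> of the span of the normal words in the quotient;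
  using representatives, no quotient type has to be formed.\<close>

definition nspan :: "'k::comm_ring_1 \<Rightarrow> 'x set \<Rightarrow> ('x letter list \<Rightarrow> 'k) set" where
  "nspan lam X = {f. \<exists>g h. finite {w. g w \<noteq> 0} \<and> (\<forall>w. g w \<noteq> 0 \<longrightarrow> nfw X w) \<and> h \<in> IdS lam X \<and>
     f = (\<lambda>w. g w + h w)}"

lemma ksubmodule_setsum:
  assumes "ksubmodule S" "ksubmodule T"
  shows "ksubmodule {f. \<exists>g h. g \<in> S \<and> h \<in> T \<and> f = (\<lambda>w. g w + h w)}" (is "ksubmodule ?U")
  unfolding ksubmodule_def
proof (intro conjI ballI allI)
  have U: "(\<lambda>w. g w + h w) \<in> ?U" if "g \<in> S" "h \<in> T" for g h using that by blast
  show "(\<lambda>w. 0) \<in> ?U" using U[OF ksubmodule_zero ksubmodule_zero, OF assms] by simp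
  fix f f' a assume "f \<in> ?U"
  then obtain g h where f: "g \<in> S" "h \<in> T" "f = (\<lambda>w. g w + h w)" by blast
  show "(\<lambda>w. a * f w) \<in> ?U"
    using U[OF ksubmodule_smul[OF assms(1) f(1), of a] ksubmodule_smul[OF assms(2) f(2), of a]]
    by (simp add: f(3) distrib_left)
  assume "f' \<in> ?U"
  then obtain g' h' where f': "g' \<in> S" "h' \<in> T" "f' = (\<lambda>w. g' w + h' w)" by blast
  show "(\<lambda>w. f w + f' w) \<in> ?U"
    using U[OF ksubmodule_add[OF assms(1) f(1) f'(1)] ksubmodule_add[OF assms(2) f(2) f'(2)]]
    by (simp add: f(3) f'(3) algebra_simps)
qed

lemma ksubmodule_nspan: "ksubmodule (nspan lam X)"
  using ksubmodule_setsum[OF ksubmodule_supported ksubmodule_IdS] unfolding nspan_def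
  by (simp add: conj_assoc)

lemma IdS_subset_nspan: "IdS lam X \<subseteq> nspan lam X"
proof
  fix h assume "h \<in> IdS lam X"
  then show "h \<in> nspan lam X"
    unfolding nspan_def by (intro CollectI exI[of _ "\<lambda>w. 0"] exI[of _ h]) auto
qed

lemma delta_in_nspan: "nfw X w \<Longrightarrow> delta w \<in> nspan lam X"
  unfolding nspan_def
  by (intro CollectI exI[of _ "delta w"] exI[of _ "\<lambda>w. 0"])
     (auto simp: delta_def ksubmodule_zero[OF ksubmodule_IdS])

lemma nspan_linear:
  assumes L: "flinear L" and "\<And>w. nfw X w \<Longrightarrow> L (delta w) \<in> nspan lam X"
    and "\<And>h. h \<in> IdS lam X \<Longrightarrow> L h \<in> nspan lam X" and "f \<in> nspan lam X"
  shows "L f \<in> nspan lam X"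
proof -
  obtain g h where gh: "finite {w. g w \<noteq> 0}" "\<And>w. g w \<noteq> 0 \<Longrightarrow> nfw X w" "h \<in> IdS lam X"
    and f: "f = (\<lambda>w. g w + h w)"
    using assms(4) unfolding nspan_def by blast
  have "g \<in> {f. L f \<in> nspan lam X}"
    by (rule supported_subset[OF ksubmodule_vimage[OF L ksubmodule_nspan], of "nfw X"]) (use gh assms(2) in auto)
  then have "(\<lambda>w. L g w + L h w) \<in> nspan lam X"
    using assms(3)[OF gh(3)] by (intro ksubmodule_add[OF ksubmodule_nspan]) auto
  then show ?thesis using L by (simp add: f flinear_def)
qed

lemma flinear_msub_apply: "flinear L \<Longrightarrow> L (msub f g) = msub (L f) (L g)"
  and flinear_msmul_apply: "flinear L \<Longrightarrow> L (msmul a f) = msmul a (L f)"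
proof -
  assume L: "flinear L"
  then show *: "L (msmul a f) = msmul a (L f)" for a f by (simp add: flinear_def msmul_def)
  have "L (madd f h) = madd (L f) (L h)" for h using L by (simp add: flinear_def madd_def)
  from this[of "msmul (-1) g"] show "L (msub f g) = msub (L f) (L g)"
    unfolding * by (simp add: msub_def madd_def msmul_def)
qed

text \<open>If P(z)P(y) arises at the junction, the Rota-Baxter relation trades it for P of the
  products zP(y), P(z)y and zy, whose factors have smaller total size. The hypothesis puts these
  products into \<open>nspan\<close>, though they need not be normal.\<close>

lemma nspan_append: "nfw X u \<Longrightarrow> nfw X v \<Longrightarrow> delta (u @ v) \<in> nspan lam X"
proof (induction "size_list size u + size_list size v" arbitrary: u v rule: less_induct)
  case less
  show ?case
  proof (cases "isPL (last u) \<and> isPL (hd v)")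
    case False
    then have "nfw X (u @ v)"
      using less.prems by (auto simp: nfw_def successively_append_iff)
    then show ?thesis by (rule delta_in_nspan)
  next
    case True
    have "u \<noteq> []" "v \<noteq> []" using less.prems by (auto simp: nfw_def)
    with True obtain u1 z v1 y where u: "u = u1 @ [PL z]" and v: "v = PL y # v1"
      by (metis append_butlast_last_id isPL_iff list.collapse)
    have z: "nfw X z" and y: "nfw X y"
      using less.prems by (auto simp: u v nfw_def[of X "_ @ _"] nfw_def[of X "_ # _"])
    have wf: "\<forall>a\<in>set u1. wfl X a" "\<forall>a\<in>set v1. wfl X a"
      using less.prems by (auto simp: u v nfw_def nfl_wfl)
    \<comment> \<open>\<open>L f\<close> is u1 P(f) v1, with P(f) replacing the two adjacent
      P-letters. As \<open>u\<close> and \<open>v\<close> are normal, \<open>u1\<close> does not end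
      and \<open>v1\<close> does not begin with a P-letter, so \<open>L\<close> sends normal words
      to normal words.\<close>
    define L' :: "('a letter list \<Rightarrow> 'b) \<Rightarrow> _" where "L' f = mmul (mmul (delta u1) f) (delta v1)" for f
    define L where "L f = L' (mP f)" for f
    have L': "flinear L'" unfolding L'_def by (intro flinear_intros)
    then have L: "flinear L" unfolding L_def by (rule flinear_comp[OF _ flinear_mP])
    have L'_IdS: "L' f \<in> IdS lam X" if "f \<in> IdS lam X" for f
      unfolding L'_def using that wf by (intro IdS_mmul_delta_left IdS_mmul_delta_right)
    have L_nspan: "L f \<in> nspan lam X" if "f \<in> nspan lam X" for f
      using L _ _ that
    proof (rule nspan_linear)
      show "L h \<in> nspan lam X" if "h \<in> IdS lam X" for h
        using that L'_IdS IdS_mP IdS_subset_nspan unfolding L_def by blast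
      fix t assume "nfw X t"
      then have "nfw X (u1 @ [PL t] @ v1)"
        using less.prems by (auto simp: u v nfw_def successively_append_iff successively_Cons)
      then show "L (delta t) \<in> nspan lam X"
        unfolding L_def L'_def using delta_in_nspan by simp
    qed
    have "delta (z @ [PL y]) \<in> nspan lam X" "delta ([PL z] @ y) \<in> nspan lam X" "delta (z @ y) \<in> nspan lam X"
      by (rule less.hyps; use z y in \<open>simp add: u v nfw_PL\<close>)+
    note IH = this[THEN L_nspan]
    have "L' (rbpoly lam (delta z) (delta y)) = msub (msub (msub (delta (u @ v))
        (L (delta (z @ [PL y])))) (L (delta ([PL z] @ y)))) (msmul lam (L (delta (z @ y))))"
      unfolding rbpoly_def flinear_msub_apply[OF L'] flinear_msmul_apply[OF L'] L_def
      by (simp add: L'_def u v)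
    moreover have "L' (rbpoly lam (delta z) (delta y)) \<in> nspan lam X"
      using z y by (intro subsetD[OF IdS_subset_nspan] L'_IdS rbpoly_in_IdS) (simp_all add: nfw_wfw)
    \<comment> \<open>The relation solved for its leading word \<open>u @ v\<close>.\<close>
    ultimately have "madd (madd (madd (L' (rbpoly lam (delta z) (delta y))) (L (delta (z @ [PL y]))))
        (L (delta ([PL z] @ y)))) (msmul lam (L (delta (z @ y)))) = delta (u @ v)"
      "L' (rbpoly lam (delta z) (delta y)) \<in> nspan lam X"
      by (simp_all add: madd_def msub_def msmul_def)
    with IH show ?thesis
      by (metis ksubmodule_madd ksubmodule_msmul ksubmodule_nspan)
  qed
qed

lemma supported_nfw_OMod: "finite {w. g w \<noteq> 0} \<Longrightarrow> \<forall>w. g w \<noteq> 0 \<longrightarrow> nfw X w \<Longrightarrow> g \<in> OMod X"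
  by (auto simp: OMod_def nfw_wfw)

lemma nspan_subset_OMod: "nspan lam X \<subseteq> OMod X"
proof
  fix f assume "f \<in> nspan lam X"
  then obtain g h where g: "finite {w. g w \<noteq> 0}" "\<forall>w. g w \<noteq> 0 \<longrightarrow> nfw X w"
    and h: "h \<in> IdS lam X" and f: "f = (\<lambda>w. g w + h w)"
    unfolding nspan_def by blast
  show "f \<in> OMod X"
    unfolding f using supported_nfw_OMod[OF g] subsetD[OF IdS_subset_OMod h]
    by (rule ksubmodule_add[OF ksubmodule_OMod])
qed

lemma nspan_mmul:
  assumes f: "f \<in> nspan lam X" and g: "g \<in> nspan lam X" shows "mmul f g \<in> nspan lam X"
proof -
  have OM: "f \<in> OMod X" "g \<in> OMod X" using assms nspan_subset_OMod by auto
  show ?thesis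
  proof (rule nspan_linear[OF flinear_mmul1 _ _ f])
    show "mmul h g \<in> nspan lam X" if "h \<in> IdS lam X" for h
      using that OM IdS_mmul_right IdS_subset_nspan by blast
    show "mmul (delta u) g \<in> nspan lam X" if u: "nfw X u" for u
    proof (rule nspan_linear[OF flinear_mmul2 _ _ g])
      show "mmul (delta u) h \<in> nspan lam X" if "h \<in> IdS lam X" for h
        using that u nfw_wfw delta_in_OMod IdS_mmul_left IdS_subset_nspan by blast
    qed (simp add: u nspan_append)
  qed
qed

lemma nspan_mP: "f \<in> nspan lam X \<Longrightarrow> mP f \<in> nspan lam X"
  by (rule nspan_linear[OF flinear_mP])
     (auto simp: nfw_PL intro: delta_in_nspan IdS_mP IdS_subset_nspan[THEN subsetD])

lemma nspan_DL_letter: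
  assumes "nfl X a" shows "delta [DL [a]] \<in> nspan lam X"
  using assms
proof (cases rule: nfl_cases')
  case (gen i x)
  then have "nfw X [DL [a]]" using nfl_Dpow[of x X "Suc i"] by (simp add: nfw_def)
  then show ?thesis by (rule delta_in_nspan)
next
  case (op z)
  then have "pdpoly (delta z) \<in> nspan lam X"
    by (intro subsetD[OF IdS_subset_nspan] pdpoly_in_IdS) (simp add: nfw_wfw)
  then have "madd (pdpoly (delta z)) (delta z) \<in> nspan lam X"
    using op(1) by (intro ksubmodule_madd[OF ksubmodule_nspan] delta_in_nspan)
  then show ?thesis using op(2) by (simp add: pdpoly_def madd_def msub_def)
qed

text \<open>The Leibniz relation splits off the first letter. For a single letter, D(D^i(x)) is
  normal and D(P(z)) reduces to z. The products that arise need not be normal words, hence the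
  appeal to \<open>nspan_mmul\<close>.\<close>

lemma nspan_DL:
  assumes "nfw X w" shows "delta [DL w] \<in> nspan lam X"
proof -
  have "w \<noteq> []" using assms by (simp add: nfw_def)
  then show ?thesis using assms
  proof (induction w rule: list_nonempty_induct)
    case (single a)
    then show ?case by (intro nspan_DL_letter) (simp add: nfw_def)
  next
    case (cons a w)
    then have a: "nfw X [a]" and w: "nfw X w" by (auto simp: nfw_def successively_Cons)
    then have Da: "delta [DL [a]] \<in> nspan lam X" by (intro nspan_DL_letter) (simp add: nfw_def)
    have "dpoly lam (delta [a]) (delta w) \<in> nspan lam X"
      using a w by (intro subsetD[OF IdS_subset_nspan] dpoly_in_IdS) (simp_all add: nfw_wfw)
    moreover have "mmul (mD (delta [a])) (delta w) \<in> nspan lam X" "mmul (delta [a]) (mD (delta w)) \<in> nspan lam X"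
      "mmul (mD (delta [a])) (mD (delta w)) \<in> nspan lam X"
      unfolding mD_delta
      using nspan_mmul[OF Da delta_in_nspan[OF w]] nspan_mmul[OF delta_in_nspan[OF a] cons.IH[OF w]]
        nspan_mmul[OF Da cons.IH[OF w]] by auto
    moreover have "delta [DL (a # w)] = madd (madd (madd (dpoly lam (delta [a]) (delta w))
        (mmul (mD (delta [a])) (delta w))) (mmul (delta [a]) (mD (delta w))))
        (msmul lam (mmul (mD (delta [a])) (mD (delta w))))"
      unfolding dpoly_def by (simp add: madd_def msub_def msmul_def del: mmul_delta_delta)
         (simp add: mmul_delta_delta)
    ultimately show ?case
      by (metis ksubmodule_madd ksubmodule_msmul ksubmodule_nspan)
  qed
qed

lemma nspan_mD: "f \<in> nspan lam X \<Longrightarrow> mD f \<in> nspan lam X"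
  by (rule nspan_linear[OF flinear_mD])
     (simp_all add: nspan_DL IdS_mD IdS_subset_nspan[THEN subsetD])

lemma delta_wfw_in_nspan:
  assumes "wfw X w" shows "delta w \<in> nspan lam X"
proof -
  have word: "delta w \<in> nspan lam X" if "w \<noteq> []" "\<forall>a\<in>set w. delta [a] \<in> nspan lam X" for w
    using that
  proof (induction w rule: list_nonempty_induct)
    case (cons a w)
    then show ?case using nspan_mmul[of "delta [a]" lam X "delta w"] by simp
  qed simp
  have "delta [a] \<in> nspan lam X" if "wfl X a" for a
    using that
  proof (induction rule: wfl.induct)
    case (wfl_V x)
    then have "nfw X [V x]" using nfl_Dpow[of x X 0] by (simp add: nfw_def)
    then show ?case by (rule delta_in_nspan)
  next
    case (wfl_P u)
    then show ?case using nspan_mP[OF word[of u]] by simp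
  next
    case (wfl_D u)
    then show ?case using nspan_mD[OF word[of u]] by simp
  qed
  then show ?thesis using assms word[of w] by (simp add: wfw_def)
qed

lemma OMod_reduce:
  assumes "f \<in> OMod X"
  shows "\<exists>g\<in>OMod X. (\<forall>w. g w \<noteq> 0 \<longrightarrow> w \<in> PhiD X) \<and> msub f g \<in> IdS lam X"
proof -
  have "f \<in> nspan lam X"
    using OMod_subset[OF ksubmodule_nspan, of X lam X] delta_wfw_in_nspan assms by blast
  then obtain g h where "finite {w. g w \<noteq> 0}" "\<forall>w. g w \<noteq> 0 \<longrightarrow> nfw X w" "h \<in> IdS lam X"
    and f: "f = (\<lambda>w. g w + h w)"
    unfolding nspan_def by blast
  then show ?thesis
    by (intro bexI[of _ g]) (auto simp: PhiD_eq_nfw msub_def supported_nfw_OMod)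
qed

section \<open>The algebra of normal words\<close>

lift_definition pscale :: "'k::comm_ring_1 \<Rightarrow> ('a \<Rightarrow>\<^sub>0 'k) \<Rightarrow> ('a \<Rightarrow>\<^sub>0 'k)"
  is "\<lambda>a f w. a * f w"
  by (rule finite_subset) auto

lemma lookup_pscale [simp]: "Poly_Mapping.lookup (pscale a f) w = a * Poly_Mapping.lookup f w"
  by transfer simp

interpretation pm: module "pscale :: 'k::comm_ring_1 \<Rightarrow> ('a \<Rightarrow>\<^sub>0 'k) \<Rightarrow> _"
  by unfold_locales (auto intro!: poly_mapping_eqI simp: lookup_add algebra_simps)

abbreviation bas :: "'a \<Rightarrow> ('a \<Rightarrow>\<^sub>0 'k::comm_ring_1)" where
  "bas w \<equiv> Poly_Mapping.single w 1"

definition plinear :: "(('a \<Rightarrow>\<^sub>0 'k::comm_ring_1) \<Rightarrow> ('b \<Rightarrow>\<^sub>0 'k)) \<Rightarrow> bool" where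
  "plinear L \<longleftrightarrow> (\<forall>x y. L (x + y) = L x + L y) \<and> (\<forall>a x. L (pscale a x) = pscale a (L x))"

lemma plinear_zero: "plinear L \<Longrightarrow> L 0 = 0"
  unfolding plinear_def by (metis add_cancel_left_left)

lemma plinear_sum: "plinear L \<Longrightarrow> L (sum f A) = (\<Sum>a\<in>A. L (f a))"
  by (induction A rule: infinite_finite_induct) (auto simp: plinear_zero, simp add: plinear_def)

lemma bas_expand: "x = (\<Sum>w\<in>Poly_Mapping.keys x. pscale (Poly_Mapping.lookup x w) (bas w))"
  by (rule poly_mapping_eqI)
     (auto simp: lookup_sum lookup_single when_def in_keys_iff if_distrib sum.delta cong: if_cong)

text \<open>Finite support is built into the type, so agreement on basis elements suffices without
  side conditions; the identities of the model are reduced to basis words in this way.\<close>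

lemma plinear_ext:
  assumes "plinear L" "plinear M" "\<And>w. L (bas w) = M (bas w)"
  shows "L x = M x"
proof -
  have "L x = (\<Sum>w\<in>Poly_Mapping.keys x. pscale (Poly_Mapping.lookup x w) (L (bas w)))"
    using assms(1) by (subst bas_expand, subst plinear_sum) (auto simp: plinear_def)
  also have "\<dots> = (\<Sum>w\<in>Poly_Mapping.keys x. pscale (Poly_Mapping.lookup x w) (M (bas w)))"
    by (simp add: assms(3))
  also have "\<dots> = M x"
    using assms(2) by (subst (3) bas_expand, subst plinear_sum) (auto simp: plinear_def)
  finally show ?thesis .
qed

definition lext :: "('a \<Rightarrow> ('b \<Rightarrow>\<^sub>0 'k)) \<Rightarrow> ('a \<Rightarrow>\<^sub>0 'k::comm_ring_1) \<Rightarrow> ('b \<Rightarrow>\<^sub>0 'k)" where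
  "lext F x = (\<Sum>w\<in>Poly_Mapping.keys x. pscale (Poly_Mapping.lookup x w) (F w))"

lemma lext_superset:
  assumes "finite A" "Poly_Mapping.keys x \<subseteq> A"
  shows "lext F x = (\<Sum>w\<in>A. pscale (Poly_Mapping.lookup x w) (F w))"
  unfolding lext_def by (rule sum.mono_neutral_left) (use assms in \<open>auto simp: in_keys_iff\<close>)

lemma plinear_lext [simp]: "plinear (lext F)"
  unfolding plinear_def
proof safe
  fix x y :: "'a \<Rightarrow>\<^sub>0 'b" and a :: 'b
  let ?A = "Poly_Mapping.keys x \<union> Poly_Mapping.keys y"
  have "Poly_Mapping.keys (x + y) \<subseteq> ?A" by (rule keys_add)
  then have "lext F (x + y) = (\<Sum>w\<in>?A. pscale (Poly_Mapping.lookup (x + y) w) (F w))"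
    by (intro lext_superset) auto
  also have "\<dots> = lext F x + lext F y"
    by (simp add: lext_superset[of ?A] lookup_add pm.scale_left_distrib sum.distrib)
  finally show "lext F (x + y) = lext F x + lext F y" .
  have "Poly_Mapping.keys (pscale a x) \<subseteq> Poly_Mapping.keys x"
    by (auto simp: in_keys_iff)
  then have "lext F (pscale a x) = (\<Sum>w\<in>Poly_Mapping.keys x. pscale (Poly_Mapping.lookup (pscale a x) w) (F w))"
    by (intro lext_superset) auto
  then show "lext F (pscale a x) = pscale a (lext F x)"
    by (simp add: lext_def pm.scale_sum_right)
qed

lemma lext_bas [simp]: "lext F (bas w) = F w"
  by (subst lext_superset[of "{w}"]) auto

lemma lext_add [simp]: "lext F (x + y) = lext F x + lext F y"
  and lext_pscale [simp]: "lext F (pscale a x) = pscale a (lext F x)"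
  using plinear_lext[of F] by (auto simp: plinear_def)

lemma plinear_lext_param:
  assumes "\<And>u. plinear (L u)"
  shows "plinear (\<lambda>y. lext (\<lambda>u. L u y) x)"
  using assms by (auto simp: plinear_def lext_def pm.scale_right_distrib sum.distrib
      pm.scale_sum_right mult.commute)

lemma plinear_id: "plinear (\<lambda>x. x)"
  and plinear_comp: "plinear L \<Longrightarrow> plinear M \<Longrightarrow> plinear (\<lambda>x. L (M x))"
  and plinear_add: "plinear L \<Longrightarrow> plinear M \<Longrightarrow> plinear (\<lambda>x. L x + M x)"
  and plinear_pscale: "plinear L \<Longrightarrow> plinear (\<lambda>x. pscale a (L x))"
  by (auto simp: plinear_def algebra_simps pm.scale_right_distrib)

text \<open>The normal words together with the empty word, as a free datatype: NG i x w and NPG z i x w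
  stand for \<open>D\<^sup>i(x)w\<close> and \<open>P(z)D\<^sup>i(x)w\<close>. No two adjacent P-letters can be written down.\<close>
datatype 'x nword =
    NE
  | NP "'x nword"
  | NG nat 'x "'x nword"
  | NPG "'x nword" nat 'x "'x nword"

definition pP :: "('x nword \<Rightarrow>\<^sub>0 'k::comm_ring_1) \<Rightarrow> ('x nword \<Rightarrow>\<^sub>0 'k)" where
  "pP = lext (\<lambda>w. bas (NP w))"

definition pG :: "nat \<Rightarrow> 'x \<Rightarrow> ('x nword \<Rightarrow>\<^sub>0 'k::comm_ring_1) \<Rightarrow> ('x nword \<Rightarrow>\<^sub>0 'k)" where
  "pG i x = lext (\<lambda>w. bas (NG i x w))"

definition pPG :: "nat \<Rightarrow> 'x \<Rightarrow> ('x nword \<Rightarrow>\<^sub>0 'k::comm_ring_1) \<Rightarrow> ('x nword \<Rightarrow>\<^sub>0 'k) \<Rightarrow> ('x nword \<Rightarrow>\<^sub>0 'k)" where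
  "pPG i x z y = lext (\<lambda>u. lext (\<lambda>w. bas (NPG u i x w)) y) z"

lemma pP_bas [simp]: "pP (bas w) = bas (NP w)"
  and pG_bas [simp]: "pG i x (bas w) = bas (NG i x w)"
  and pPG_bas [simp]: "pPG i x (bas z) (bas w) = bas (NPG z i x w)"
  by (simp_all add: pP_def pG_def pPG_def)

lemma plinear_pP: "plinear pP"
  and plinear_pG: "plinear (pG i x)"
  and plinear_pPG1: "plinear (\<lambda>z. pPG i x z y)"
  and plinear_pPG2: "plinear (\<lambda>y. pPG i x z y)"
  unfolding pP_def pG_def pPG_def by (simp_all add: plinear_lext_param)

text \<open>Only the case of two adjacent letters P(z)P(y) is not a concatenation: there the
  Rota-Baxter identity is used as a rewrite rule.\<close>
function mulw :: "'k::comm_ring_1 \<Rightarrow> 'x nword \<Rightarrow> 'x nword \<Rightarrow> ('x nword \<Rightarrow>\<^sub>0 'k)" where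
  "mulw lam NE v = bas v"
| "mulw lam (NG i x u) v = pG i x (mulw lam u v)"
| "mulw lam (NPG z i x u) v = pPG i x (bas z) (mulw lam u v)"
| "mulw lam (NP z) NE = bas (NP z)"
| "mulw lam (NP z) (NG i x v) = bas (NPG z i x v)"
| "mulw lam (NP z) (NP y) =
     pP (mulw lam z (NP y) + mulw lam (NP z) y + pscale lam (mulw lam z y))"
| "mulw lam (NP z) (NPG y i x v) =
     pPG i x (mulw lam z (NP y) + mulw lam (NP z) y + pscale lam (mulw lam z y)) (bas v)"
  by pat_completeness auto
termination by (relation "measure (\<lambda>(lam, u, v). size u + size v)") auto

section \<open>Product and derivation of the model\<close>

context
  fixes lam :: "'k::comm_ring_1"
begin

definition pmul :: "('x nword \<Rightarrow>\<^sub>0 'k) \<Rightarrow> ('x nword \<Rightarrow>\<^sub>0 'k) \<Rightarrow> ('x nword \<Rightarrow>\<^sub>0 'k)" where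
  "pmul x y = lext (\<lambda>u. lext (mulw lam u) y) x"

lemma pmul_bas: "pmul (bas u) (bas v) = mulw lam u v"
  by (simp add: pmul_def)

lemma plinear_pmul1: "plinear (\<lambda>x. pmul x y)"
  and plinear_pmul2: "plinear (\<lambda>y. pmul x y)"
  unfolding pmul_def by (simp_all add: plinear_lext_param)

lemma pmul_1_left [simp]: "pmul (bas NE) y = y"
  by (rule plinear_ext[of "\<lambda>y. pmul (bas NE) y" "\<lambda>y. y"]) (auto simp: plinear_pmul2 plinear_id pmul_bas)

lemma mulw_NE [simp]: "mulw lam u NE = bas u"
  by (induction u) auto

lemma pmul_1_right [simp]: "pmul y (bas NE) = y"
  by (rule plinear_ext[of "\<lambda>y. pmul y (bas NE)" "\<lambda>y. y"]) (auto simp: plinear_pmul1 plinear_id pmul_bas)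

text \<open>The Rota-Baxter double product, for which \<open>P(x)P(y) = P(pB x y)\<close>.\<close>
definition pB :: "('x nword \<Rightarrow>\<^sub>0 'k) \<Rightarrow> ('x nword \<Rightarrow>\<^sub>0 'k) \<Rightarrow> ('x nword \<Rightarrow>\<^sub>0 'k)" where
  "pB x y = pmul x (pP y) + pmul (pP x) y + pscale lam (pmul x y)"

lemma pB_bas: "pB (bas u) (bas v) =
   mulw lam u (NP v) + mulw lam (NP u) v + pscale lam (mulw lam u v)"
  by (simp add: pB_def pmul_bas)

lemma plinear_pB1: "plinear (\<lambda>x. pB x y)"
  unfolding pB_def
  by (intro plinear_add plinear_pscale plinear_pmul1 plinear_comp[OF plinear_pmul1 plinear_pP])

lemma plinear_pB2: "plinear (\<lambda>y. pB x y)"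
  unfolding pB_def
  by (intro plinear_add plinear_pscale plinear_pmul2 plinear_comp[OF plinear_pmul2 plinear_pP])

lemma plinear2_ext:
  assumes "\<And>y. plinear (\<lambda>x. L x y)" "\<And>x. plinear (\<lambda>y. L x y)"
    and "\<And>y. plinear (\<lambda>x. M x y)" "\<And>x. plinear (\<lambda>y. M x y)"
    and "\<And>u v. L (bas u) (bas v) = M (bas u) (bas v)"
  shows "L x y = M x y"
  by (rule plinear_ext[OF assms(1) assms(3)], rule plinear_ext[OF assms(2) assms(4)], rule assms(5))

lemma plinear3_ext:
  assumes "\<And>y z. plinear (\<lambda>x. L x y z)" "\<And>x z. plinear (\<lambda>y. L x y z)" "\<And>x y. plinear (\<lambda>z. L x y z)"
    and "\<And>y z. plinear (\<lambda>x. M x y z)" "\<And>x z. plinear (\<lambda>y. M x y z)" "\<And>x y. plinear (\<lambda>z. M x y z)"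
    and "\<And>u v w. L (bas u) (bas v) (bas w) = M (bas u) (bas v) (bas w)"
  shows "L x y z = M x y z"
  by (rule plinear_ext[OF assms(1) assms(4)], rule plinear_ext[OF assms(2) assms(5)],
      rule plinear_ext[OF assms(3) assms(6)], rule assms(7))

lemmas plin_intros = plinear_id plinear_add plinear_pscale
  plinear_pmul1 plinear_pmul2 plinear_pP plinear_pG plinear_pPG1 plinear_pPG2 plinear_pB1 plinear_pB2
  plinear_comp[OF plinear_pmul1] plinear_comp[OF plinear_pmul2]
  plinear_comp[OF plinear_pP] plinear_comp[OF plinear_pG]
  plinear_comp[OF plinear_pPG1] plinear_comp[OF plinear_pPG2]
  plinear_comp[OF plinear_pB1] plinear_comp[OF plinear_pB2]

text \<open>This and the next four lemmas carry the equations of \<open>mulw\<close> from basis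
  words to arbitrary elements. To compute with them, later proofs fold basis words back into
  \<open>pP\<close>, \<open>pG\<close> and \<open>pPG\<close>, whence
  \<open>flip: pP_bas\<close>.\<close>

lemma pmul_pG [simp]: "pmul (pG i g x) y = pG i g (pmul x y)"
  by (rule plinear2_ext[where L = "\<lambda>x y. pmul (pG i g x) y"]) (auto simp: pmul_bas intro: plin_intros)

lemma pmul_pPG [simp]: "pmul (pPG i g z x) y = pPG i g z (pmul x y)"
  by (rule plinear3_ext[where L = "\<lambda>z x y. pmul (pPG i g z x) y"])
     (auto simp: pmul_bas intro: plin_intros)

lemma pmul_pP_pG [simp]: "pmul (pP z) (pG i g y) = pPG i g z y"
  by (rule plinear2_ext[where L = "\<lambda>z y. pmul (pP z) (pG i g y)"]) (auto simp: pmul_bas intro: plin_intros)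

lemma pmul_pP_pP [simp]: "pmul (pP z) (pP y) = pP (pB z y)"
  by (rule plinear2_ext[where L = "\<lambda>z y. pmul (pP z) (pP y)"])
     (auto simp: pmul_bas pB_bas intro: plin_intros)

lemma pmul_pP_pPG [simp]: "pmul (pP z) (pPG i g y w) = pPG i g (pB z y) w"
  by (rule plinear3_ext[where L = "\<lambda>z y w. pmul (pP z) (pPG i g y w)"])
     (auto simp: pmul_bas pB_bas intro: plin_intros)

lemma pmul_add_left: "pmul (x + y) z = pmul x z + pmul y z"
  and pmul_add_right: "pmul z (x + y) = pmul z x + pmul z y"
  and pmul_pscale_left: "pmul (pscale a x) y = pscale a (pmul x y)"
  and pmul_pscale_right: "pmul x (pscale a y) = pscale a (pmul x y)"
  using plinear_pmul1[of y] plinear_pmul1[of z] plinear_pmul2[of x] plinear_pmul2[of z]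
  by (auto simp: plinear_def)

lemma pP_add: "pP (x + y) = pP x + pP y"
  and pP_pscale: "pP (pscale a x) = pscale a (pP x)"
  using plinear_pP by (auto simp: plinear_def)

lemmas pdistrib = pmul_add_left pmul_add_right pmul_pscale_left pmul_pscale_right
  pP_add pP_pscale pm.scale_right_distrib

text \<open>\<open>pG\<close> and \<open>pPG\<close> move out of the first factor, so a word
  starting with D^i(x) or P(z)D^i(x) reduces to its tail. For the first factor P(a), a generator in
  the second factor shields the third; what remains is P(a)P(b) times \<open>w\<close>, which
  depends on associativity of \<open>pB\<close>.\<close>

lemma pmul_assoc_bas:
  "pmul (pmul (bas u) (bas v)) (bas w) = pmul (bas u) (pmul (bas v) (bas w))"
proof (induction "size u + size v + size w" arbitrary: u v w rule: less_induct)
  case less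
  show ?case
  proof (cases u)
    case (NG i g u')
    then show ?thesis using less[of u' v w] by (simp flip: pG_bas)
  next
    case (NPG z i g u')
    then show ?thesis using less[of u' v w] by (simp flip: pPG_bas)
  next
    case u: (NP a)
    show ?thesis
    proof (cases v)
      case v: (NP b)
      \<comment> \<open>Associativity of the double product needs associativity only for triples of smaller total size.\<close>
      have B: "pB (pB (bas a) (bas b)) (bas c) = pB (bas a) (pB (bas b) (bas c))"
        if "size c < size w" for c
      proof -
        let ?a = "bas a :: _ \<Rightarrow>\<^sub>0 'k" and ?b = "bas b :: _ \<Rightarrow>\<^sub>0 'k" and ?c = "bas c :: _ \<Rightarrow>\<^sub>0 'k"
        \<comment> \<open>Each triple drops at least one of the three P's, and \<open>NP c\<close>
          is no larger than \<open>w\<close>, so the induction hypothesis applies to all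
          seven.\<close>
        have "pmul (pmul ?a ?b) ?c = pmul ?a (pmul ?b ?c)"
          "pmul (pmul ?a ?b) (pP ?c) = pmul ?a (pmul ?b (pP ?c))"
          "pmul (pmul ?a (pP ?b)) ?c = pmul ?a (pmul (pP ?b) ?c)"
          "pmul (pmul ?a (pP ?b)) (pP ?c) = pmul ?a (pP (pB ?b ?c))"
          "pmul (pmul (pP ?a) ?b) ?c = pmul (pP ?a) (pmul ?b ?c)"
          "pmul (pmul (pP ?a) ?b) (pP ?c) = pmul (pP ?a) (pmul ?b (pP ?c))"
          "pmul (pP (pB ?a ?b)) ?c = pmul (pP ?a) (pmul (pP ?b) ?c)"
          unfolding pmul_pP_pP[symmetric] unfolding pP_bas
          by (rule less; use u v that in simp)+
        note assoc = this
        have "pB (pB ?a ?b) ?c = pmul (pB ?a ?b) (pP ?c) + pmul (pP (pB ?a ?b)) ?c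
                + pscale lam (pmul (pB ?a ?b) ?c)"
          by (simp add: pB_def)
        also have "\<dots> = pmul ?a (pP (pB ?b ?c)) + pmul (pP ?a) (pB ?b ?c)
                + pscale lam (pmul ?a (pB ?b ?c))"
          unfolding assoc(7) unfolding pB_def[of ?a ?b]
          by (simp only: pdistrib assoc(1-6)) (simp add: pB_def pdistrib algebra_simps del: pP_bas)
        finally show ?thesis by (simp add: pB_def)
      qed
      show ?thesis
        by (cases w) (simp_all add: u v B flip: pP_bas pG_bas pPG_bas)
    qed (simp_all add: u flip: pP_bas pG_bas pPG_bas)
  qed simp
qed

lemma pmul_assoc: "pmul (pmul x y) z = pmul x (pmul y z)"
  by (rule plinear3_ext[where L = "\<lambda>x y z. pmul (pmul x y) z"])
     (auto simp: pmul_assoc_bas intro: plin_intros)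

text \<open>The clauses are the Leibniz rule together with DP = id; the unit is a constant. In the
  last clause \<open>dg\<close> is the derivative of D^i(x)w, spelled out because primitive
  recursion offers \<open>derw w\<close> but not \<open>derw (NG i x w)\<close>.\<close>

primrec derw :: "'x nword \<Rightarrow> ('x nword \<Rightarrow>\<^sub>0 'k)" where
  "derw NE = 0"
| "derw (NP z) = bas z"
| "derw (NG i x w) = pG (Suc i) x (bas w) + pG i x (derw w) + pscale lam (pG (Suc i) x (derw w))"
| "derw (NPG z i x w) =
     (let dg = pG (Suc i) x (bas w) + pG i x (derw w) + pscale lam (pG (Suc i) x (derw w))
      in pmul (bas z) (bas (NG i x w)) + pmul (bas (NP z)) dg + pscale lam (pmul (bas z) dg))"

definition pD :: "('x nword \<Rightarrow>\<^sub>0 'k) \<Rightarrow> ('x nword \<Rightarrow>\<^sub>0 'k)" where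
  "pD = lext derw"

lemma plinear_pD: "plinear pD"
  by (simp add: pD_def)

lemma pD_add: "pD (x + y) = pD x + pD y"
  and pD_pscale: "pD (pscale a x) = pscale a (pD x)"
  by (simp_all add: pD_def)

lemmas plin_intros_D = plin_intros plinear_pD plinear_comp[OF plinear_pD]

lemma pD_bas: "pD (bas w) = derw w"
  by (simp add: pD_def)

lemma pD_pP [simp]: "pD (pP x) = x"
  by (rule plinear_ext[where L = "\<lambda>x. pD (pP x)" and M = "\<lambda>x. x"])
     (auto intro: plin_intros_D simp: pD_bas)

lemma pD_pG: "pD (pG i g x) = pG (Suc i) g x + pG i g (pD x) + pscale lam (pG (Suc i) g (pD x))"
  by (rule plinear_ext[where L = "\<lambda>x. pD (pG i g x)"])
     (auto intro!: plin_intros_D simp: pD_bas)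

lemma pD_pPG: "pD (pPG i g z x) =
   pmul z (pG i g x) + pmul (pP z) (pD (pG i g x)) + pscale lam (pmul z (pD (pG i g x)))"
  by (rule plinear2_ext[where L = "\<lambda>z x. pD (pPG i g z x)"])
     (intro plin_intros_D | simp add: pD_bas Let_def)+

lemma pG_add: "pG i g (x + y) = pG i g x + pG i g y"
  and pG_pscale: "pG i g (pscale a x) = pscale a (pG i g x)"
  using plinear_pG[of i g] by (auto simp: plinear_def)

text \<open>Induction on the left factor alone: if it is P(z), the cases of \<open>v\<close> follow
  from DP = id, \<open>pD_pPG\<close> and associativity, with no induction hypothesis.\<close>

lemma pD_pmul_bas: "pD (pmul (bas u) (bas v)) =
   pmul (pD (bas u)) (bas v) + pmul (bas u) (pD (bas v)) + pscale lam (pmul (pD (bas u)) (pD (bas v)))"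
proof (induction u)
  case NE
  then show ?case by (simp add: pD_def) (simp add: pmul_def lext_def)
next
  case (NG i g u)
  then show ?case
    by (simp add: pD_pG pdistrib pG_add pG_pscale algebra_simps flip: pG_bas)
next
  case (NPG z i g u)
  let ?z = "bas z :: _ \<Rightarrow>\<^sub>0 'k" and ?u = "pG i g (bas u) :: _ \<Rightarrow>\<^sub>0 'k" and ?v = "bas v :: _ \<Rightarrow>\<^sub>0 'k"
  \<comment> \<open>The Leibniz rule for D^i(x)u and v, from the hypothesis on \<open>u\<close>;
    \<open>pD_pPG\<close> then accounts for the P(z) in front.\<close>
  have *: "pD (pmul ?u ?v) = pmul (pD ?u) ?v + pmul ?u (pD ?v) + pscale lam (pmul (pD ?u) (pD ?v))"
    using NPG.IH(2)
    by (simp add: pD_pG pdistrib pG_add pG_pscale algebra_simps del: pG_bas)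
  have "pD (pPG i g ?z (pmul (bas u) ?v)) =
      pmul ?z (pmul ?u ?v) + pmul (pP ?z) (pD (pmul ?u ?v)) + pscale lam (pmul ?z (pD (pmul ?u ?v)))"
    by (simp add: pD_pPG del: pG_bas pP_bas)
  also have "\<dots> = pmul (pD (pPG i g ?z (bas u))) ?v + pmul (pmul (pP ?z) ?u) (pD ?v)
      + pscale lam (pmul (pD (pPG i g ?z (bas u))) (pD ?v))"
    unfolding * pD_pPG by (simp only: pdistrib pmul_assoc) (simp add: algebra_simps del: pG_bas pP_bas)
  finally show ?case
    by (simp del: pG_bas pP_bas flip: pPG_bas)
next
  case u: (NP z)
  show ?case
  proof (cases v)
    case NE
    then show ?thesis by (simp add: pD_def) (simp add: pmul_def lext_def)
  next
    case (NG i g w)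
    then show ?thesis by (simp add: pD_pPG flip: pP_bas pG_bas pPG_bas)
  next
    case (NP y)
    then show ?thesis by (simp add: pB_def flip: pP_bas)
  next
    case (NPG y i g w)
    let ?d = "pD (pG i g (bas w))" and ?z = "bas z :: _ \<Rightarrow>\<^sub>0 'k" and ?y = "bas y :: _ \<Rightarrow>\<^sub>0 'k"
    \<comment> \<open>P of the double product is turned back into P(z)P(y), so that associativity
      can regroup P(y) with the factor to its right.\<close>
    have "pD (pPG i g (pB ?z ?y) (bas w)) = pmul (pB ?z ?y) (pG i g (bas w))
        + pmul (pmul (pP ?z) (pP ?y)) ?d + pscale lam (pmul (pB ?z ?y) ?d)"
      by (simp only: pD_pPG pmul_pP_pP)
    also have "\<dots> = pmul ?z (pPG i g ?y (bas w)) + pmul (pP ?z) (pD (pPG i g ?y (bas w)))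
        + pscale lam (pmul ?z (pD (pPG i g ?y (bas w))))"
      unfolding pD_pPG pB_def pmul_assoc
      by (simp only: pdistrib pmul_assoc pmul_pP_pG) (simp add: algebra_simps)
    finally show ?thesis by (simp add: u NPG flip: pP_bas pPG_bas)
  qed
qed

lemma pD_pmul: "pD (pmul x y) = pmul (pD x) y + pmul x (pD y) + pscale lam (pmul (pD x) (pD y))"
  by (rule plinear2_ext[where L = "\<lambda>x y. pD (pmul x y)"])
     (intro plin_intros_D | rule pD_pmul_bas)+

end

section \<open>Linear independence\<close>

lemma ldrb_algebra_nword:
  "ldrb_algebra pscale lam (pmul lam) pP (pD lam :: ('x nword \<Rightarrow>\<^sub>0 'k::comm_ring_1) \<Rightarrow> _)"
  by unfold_locales
     (simp_all add: pdistrib pmul_assoc pD_add pD_pscale pD_pmul pB_def)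

primrec word_of :: "'x nword \<Rightarrow> 'x letter list" where
  "word_of NE = []"
| "word_of (NP z) = [PL (word_of z)]"
| "word_of (NG i x w) = Dpow i x # word_of w"
| "word_of (NPG z i x w) = PL (word_of z) # Dpow i x # word_of w"

text \<open>Translating words into \<open>nword\<close> is a partial operation, so it is given by
  existence, with \<open>word_of\<close> undoing it; this also makes it injective, as independence
  requires.\<close>

lemma evw_nfw:
  fixes lam :: "'k::comm_ring_1"
  defines "ev \<equiv> ldrb_algebra.evw (pmul lam) pP (pD lam) (\<lambda>x. bas (NG 0 x NE))"
  assumes "nfw X w"
  shows "\<exists>n. word_of n = w \<and> ev w = bas n"
  using assms(2)
proof (induction "size_list size w" arbitrary: w rule: less_induct)
  case less
  interpret ldrb_algebra pscale lam "pmul lam" pP "pD lam"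
    by (rule ldrb_algebra_nword)
  have ev_Cons: "ev (a # w) = pmul lam (ev [a]) (ev w)" if "w \<noteq> []" for a w
    using evw_append[of "[a]" w] that by (simp add: ev_def)
  \<comment> \<open>Since \<open>derw NE = 0\<close>, only the first term survives in the derivative
    of \<open>NG i x NE\<close>, so D merely raises the exponent.\<close>
  have ev_gen: "ev [Dpow i x] = bas (NG i x NE)" for i x
  proof (induction i)
    case (Suc i)
    then show ?case
      by (simp add: ev_def pD_bas plinear_zero[OF plinear_pG])
  qed (simp add: ev_def)
  have ev_op: "\<exists>n. word_of n = z \<and> ev [PL z] = bas (NP n)" if "PL z \<in> set w" for z
  proof -
    have "size (PL z) \<le> size_list size w" using that by (rule size_list_estimation') simp
    moreover have "nfw X z" using less.prems that nfl_PL_iff[of X z] unfolding nfw_def[of X w] by blast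
    ultimately obtain n where "word_of n = z" "ev z = bas n" using less.hyps[of z] by auto
    then show ?thesis by (auto simp: ev_def)
  qed
  obtain a w' where w: "w = a # w'" using less.prems by (cases w) (auto simp: nfw_def)
  then have a: "nfl X a" using less.prems by (simp add: nfw_def)
  show ?case
  proof (cases "w' = []")
    case True
    from a show ?thesis
    proof (cases rule: nfl_cases')
      case (gen i x)
      then show ?thesis using ev_gen w True by (intro exI[of _ "NG i x NE"]) simp
    next
      case (op z)
      then obtain n where "word_of n = z" "ev [PL z] = bas (NP n)" using ev_op[of z] w by auto
      then show ?thesis using op w True by (intro exI[of _ "NP n"]) simp
    qed
  next
    case False
    then have w': "nfw X w'" "\<not> (isPL a \<and> isPL (hd w'))"
      using less.prems nfw_Cons[OF False] w by auto
    then obtain n where n: "word_of n = w'" "ev w' = bas n" using less.hyps[of w'] w by auto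
    from a show ?thesis
    proof (cases rule: nfl_cases')
      case (gen i x)
      then have "ev w = pmul lam (bas (NG i x NE)) (bas n)"
        using ev_Cons[OF False] n w ev_gen by simp
      then show ?thesis using n w gen by (intro exI[of _ "NG i x n"]) (simp add: pmul_bas)
    next
      case (op z)
      then obtain m where m: "word_of m = z" "ev [PL z] = bas (NP m)"
        using ev_op[of z] w by auto
      \<comment> \<open>Normality forces a generator after the letter P(z), so the product falls
        under the concatenation clause of \<open>mulw\<close> and yields \<open>NPG\<close>.\<close>
      have "\<not> isPL (hd (word_of n))" "word_of n \<noteq> []" using w' op n False by auto
      then obtain i x n' where n': "n = NG i x n'" by (cases n) auto
      have "ev w = pmul lam (bas (NP m)) (bas n)"
        using ev_Cons[OF False] n w op m by simp
      then show ?thesis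
        using n w op m n' by (intro exI[of _ "NPG m i x n'"]) (auto simp: pmul_bas)
    qed
  qed
qed

lemma nfw_independent:
  fixes g :: "'x letter list \<Rightarrow> 'k::comm_ring_1"
  assumes g: "g \<in> OMod X" "\<And>w. g w \<noteq> 0 \<Longrightarrow> nfw X w" "g \<in> IdS lam X"
  shows "g = (\<lambda>w. 0)"
proof (rule ccontr)
  interpret ldrb_algebra pscale lam "pmul lam" pP "pD lam"
    by (rule ldrb_algebra_nword)
  let ?e = "\<lambda>x. bas (NG 0 x NE)"
  let ?A = "{w. g w \<noteq> 0}"
  assume "g \<noteq> (\<lambda>w. 0)"
  then obtain v where v: "g v \<noteq> 0" by auto
  obtain n where n: "word_of (n w) = w \<and> evw ?e w = (bas (n w) :: _ \<Rightarrow>\<^sub>0 'k)" if "g w \<noteq> 0" for w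
    using evw_nfw[OF g(2), of _ lam] by metis
  have "evalf ?e g = (\<Sum>w\<in>?A. pscale (g w) (bas (n w)))"
    unfolding evalf_def using n by (intro sum.cong) auto
  then have "Poly_Mapping.lookup (evalf ?e g) (n v) = (\<Sum>w\<in>?A. g w * (1 when n w = n v))"
    by (simp add: lookup_sum lookup_single)
  \<comment> \<open>On the support of \<open>g\<close>, \<open>n\<close> is injective because
    \<open>word_of\<close> inverts it, so the basis element \<open>n v\<close> receives the
    coefficient of \<open>v\<close> alone.\<close>
  also have "\<dots> = (\<Sum>w\<in>?A. if w = v then g w else 0)"
    using n v by (intro sum.cong) (auto simp: when_def, metis)
  also have "\<dots> = g v" using g(1) v by (simp add: OMod_def)
  finally show False using v evalf_IdS[OF g(3), of ?e] by simp
qed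

theorem theorem6p5:
  fixes lam :: "'k::comm_ring_1" and X :: "'x set"
  shows
    \<comment> \<open>Id(S) is an operated ideal of K<X;Omega>, so the quotient is an operated algebra\<close>
    "IdS lam X \<subseteq> OMod X
   \<and> (\<forall>f\<in>IdS lam X. \<forall>g\<in>OMod X. mmul f g \<in> IdS lam X \<and> mmul g f \<in> IdS lam X)
   \<and> (\<forall>f\<in>IdS lam X. mP f \<in> IdS lam X \<and> mD f \<in> IdS lam X)
    \<comment> \<open>the quotient is a lambda-differential Rota-Baxter algebra\<close>
   \<and> (\<forall>f\<in>OMod X. \<forall>g\<in>OMod X. rbpoly lam f g \<in> IdS lam X \<and> dpoly lam f g \<in> IdS lam X)
   \<and> (\<forall>f\<in>OMod X. pdpoly f \<in> IdS lam X)
    \<comment> \<open>universal property: free on X\<close>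
   \<and> (\<forall>(sm :: 'k \<Rightarrow> 'r::ring \<Rightarrow> 'r) P D e. ldrb sm lam P D \<longrightarrow>
        (\<exists>phi. qhom X (IdS lam X) sm P D e phi \<and>
           (\<forall>psi. qhom X (IdS lam X) sm P D e psi \<longrightarrow> (\<forall>f\<in>OMod X. psi f = phi f))))
    \<comment> \<open>the classes of Phi(D^omega(X)) form a K-basis of the quotient\<close>
   \<and> (\<forall>f\<in>OMod X. \<exists>g\<in>OMod X. (\<forall>w. g w \<noteq> 0 \<longrightarrow> w \<in> PhiD X) \<and> msub f g \<in> IdS lam X)
   \<and> (\<forall>g\<in>OMod X. (\<forall>w. g w \<noteq> 0 \<longrightarrow> w \<in> PhiD X) \<and> g \<in> IdS lam X \<longrightarrow> g = (\<lambda>w. 0))"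
proof (intro conjI ballI allI impI)
  show "IdS lam X \<subseteq> OMod X" by (rule IdS_subset_OMod)
  fix g :: "'x letter list \<Rightarrow> 'k"
  assume "g \<in> OMod X" "(\<forall>w. g w \<noteq> 0 \<longrightarrow> w \<in> PhiD X) \<and> g \<in> IdS lam X"
  then show "g = (\<lambda>w. 0)" by (intro nfw_independent[of g X lam]) (auto simp: PhiD_eq_nfw)
qed (simp_all add: IdS_mmul_left IdS_mmul_right IdS_mP IdS_mD rbpoly_in_IdS dpoly_in_IdS pdpoly_in_IdS
      ldrb_universal OMod_reduce)

end
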